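(* Let $(a_n)_{n\ge 0}$ be a strictly increasing real sequence with $a_0=0$ (so $a_n>0$ for $n\ge 1$) and $a_n\to\infty$ as $n\to\infty$, and suppose that for some integer $n_0\ge 2$ $$1\le \frac{a_{n-1}-a_{n-2}}{a_n-a_{n-1}}<2,\qquad\text{for all } n\ge n_0.$$ Then there exists a transcendental entire function $f$ with a Baker domain $U$ such that, for every $z\in U$, there exist $C=C(z)>1$ and $N=N(z)\in\mathbb{N}$ such that $$\frac{a_n}{C}\le |f^n(z)|\le C a_n,\qquad\text{for all } n\ge N.$$
   Context: For an entire function $f:\mathbb{C}\to\mathbb{C}$, $f^n$ denotes the $n$th iterate. The Fatou set $F(f)$ is the set of $z\in\mathbb{C}$ such that $\{f^n:n\in\mathbb{N}\}$ forms a normal family in some neighbourhood of $z$ (normality in the sense of locally uniform convergence with respect to the spherical metric, so convergence to $\infty$ is allowed). A Fatou component is a connected component of $F(f)$. For a Fatou component $U$, $U_n$ denotes the Fatou component containing $f^n(U)$; $U$ is periodic if $U_n=U$ for some $n\in\mathbb{N}$, $n\geq 1$. For a transcendental entire function $f$, a periodic Fatou component $U$ is a Baker domain if, for some $k\in\mathbb{N}$, $k\ge1$, $f^{nk}(z)\to\infty$ as $n\to\infty$ for all $z\in U$. *)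

theory Defs
  imports "HOL-Complex_Analysis.Complex_Analysis"
begin

text \<open>
  The Riemann sphere is the unit sphere of \<^typ>\<open>complex \<times> real\<close>, whose product norm is the
  Euclidean norm of three-dimensional space. The plane is embedded in it by inverse
  stereographic projection from the north pole \<open>(0, 1)\<close>, which plays the role of infinity.
  The ambient distance restricts to the chordal metric, which induces the same uniform
  convergence as the geodesic spherical metric.
\<close>

definition riemann_sphere :: "(complex \<times> real) set" where
  "riemann_sphere = sphere 0 1"

definition to_sphere :: "complex \<Rightarrow> complex \<times> real" where
  "to_sphere z =
     (2 * z / of_real (1 + (cmod z)\<^sup>2), ((cmod z)\<^sup>2 - 1) / (1 + (cmod z)\<^sup>2))"

lemma to_sphere_in_riemann_sphere: "to_sphere z \<in> riemann_sphere"
proof -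
  define r where "r = (cmod z)\<^sup>2"
  have r0: "r \<ge> 0"
    by (simp add: r_def)
  then have r: "1 + r > 0"
    by simp
  have "cmod (2 * z / of_real (1 + r)) = 2 * cmod z / (1 + r)"
    using r by (simp add: norm_divide norm_mult del: of_real_add)
  then have "(norm (to_sphere z))\<^sup>2 = (2 * cmod z / (1 + r))\<^sup>2 + ((r - 1) / (1 + r))\<^sup>2"
    using r0 by (simp add: to_sphere_def norm_prod_def power_divide flip: r_def)
  also have "\<dots> = (4 * r + (r - 1)\<^sup>2) / (1 + r)\<^sup>2"
    by (simp add: power_divide power_mult_distrib add_divide_distrib r_def)
  also have "4 * r + (r - 1)\<^sup>2 = (1 + r)\<^sup>2"
    by (simp add: power2_eq_square algebra_simps)
  also have "(1 + r)\<^sup>2 / (1 + r)\<^sup>2 = 1"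
    using r by simp
  finally show ?thesis
    by (simp add: riemann_sphere_def power2_eq_1_iff) (smt (verit) norm_ge_zero)
qed

definition spherical_locally_uniform_limit ::
    "complex set \<Rightarrow> (nat \<Rightarrow> complex \<Rightarrow> complex) \<Rightarrow> (complex \<Rightarrow> complex \<times> real) \<Rightarrow> bool" where
  "spherical_locally_uniform_limit V F g \<longleftrightarrow>
     (\<forall>z\<in>V. \<exists>W. open W \<and> z \<in> W \<and> W \<subseteq> V \<and>
        uniform_limit W (\<lambda>n w. to_sphere (F n w)) g sequentially)"

definition normal_family_on :: "complex set \<Rightarrow> (complex \<Rightarrow> complex) set \<Rightarrow> bool" where
  "normal_family_on V \<F> \<longleftrightarrow>
     (\<forall>F :: nat \<Rightarrow> complex \<Rightarrow> complex. range F \<subseteq> \<F> \<longrightarrow>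
        (\<exists>r g. strict_mono r \<and> g ` V \<subseteq> riemann_sphere \<and>
           spherical_locally_uniform_limit V (F \<circ> r) g))"

definition fatou_set :: "(complex \<Rightarrow> complex) \<Rightarrow> complex set" where
  "fatou_set f =
     {z. \<exists>V. open V \<and> z \<in> V \<and> normal_family_on V (range (\<lambda>n. f ^^ n))}"

definition fatou_component :: "(complex \<Rightarrow> complex) \<Rightarrow> complex set \<Rightarrow> bool" where
  "fatou_component f U \<longleftrightarrow> U \<in> components (fatou_set f)"

text \<open>
  The component \<open>U\<^sub>n\<close> containing \<open>f\<^sup>n(U)\<close> is given as a relation: the last argument is \<open>U\<^sub>n\<close>.
\<close>

definition fatou_component_image ::
    "(complex \<Rightarrow> complex) \<Rightarrow> complex set \<Rightarrow> nat \<Rightarrow> complex set \<Rightarrow> bool" where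
  "fatou_component_image f U n W \<longleftrightarrow> fatou_component f W \<and> (f ^^ n) ` U \<subseteq> W"

lemma fatou_component_image_unique:
  assumes "fatou_component f U" "fatou_component_image f U n W" "fatou_component_image f U n W'"
  shows "W = W'"
proof -
  have "U \<noteq> {}"
    using assms(1) in_components_nonempty unfolding fatou_component_def by blast
  then have "W \<inter> W' \<noteq> {}"
    using assms(2,3) unfolding fatou_component_image_def by blast
  then show ?thesis
    using assms(2,3) components_eq unfolding fatou_component_image_def fatou_component_def by blast
qed

definition periodic_fatou_component :: "(complex \<Rightarrow> complex) \<Rightarrow> complex set \<Rightarrow> bool" where
  "periodic_fatou_component f U \<longleftrightarrow>
     fatou_component f U \<and> (\<exists>n\<ge>1. fatou_component_image f U n U)"

definition transcendental_entire :: "(complex \<Rightarrow> complex) \<Rightarrow> bool" where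
  "transcendental_entire f \<longleftrightarrow> f holomorphic_on UNIV \<and> (\<nexists>p. f = poly p)"

definition baker_domain :: "(complex \<Rightarrow> complex) \<Rightarrow> complex set \<Rightarrow> bool" where
  "baker_domain f U \<longleftrightarrow>
     periodic_fatou_component f U \<and>
     (\<exists>k\<ge>1. \<forall>z\<in>U. filterlim (\<lambda>n. (f ^^ (n * k)) z) at_infinity sequentially)"

end

theory Submission
  imports Defs
begin

text \<open>
  The function has the form \<open>f(z) = z + h(z)\<close> with \<open>h\<close> entire, real on the real axis, and positive and
  decreasing along its positive half. There \<open>h(x)\<close> is the speed of a real orbit at the place \<open>x\<close>, so
  the rate of escape is prescribed by prescribing \<open>h\<close> on the axis. Constant factors do not matter. The
  gaps of \<open>a\<close> decrease eventually. If they stay away from zero, \<open>h(z) = 1 + e\<^sup>-\<^sup>z\<close> serves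
  (\<open>baker_domain_of_bounded_gaps\<close>). Otherwise let \<open>l\<^sub>i\<close> be the place where the gaps fall
  below \<open>A e\<^sup>-\<^sup>4\<^sup>i\<close>, moved to the right by less than \<open>2\<close> so that consecutive places are at least
  \<open>2\<^sup>-\<^sup>i\<close> apart. If \<open>h\<close> is comparable to \<open>e\<^sup>-\<^sup>4\<^sup>i\<close> between \<open>l\<^sub>i\<close> and \<open>l\<^sub>i\<^sub>+\<^sub>1\<close>, then real orbits are
  comparable to \<open>a\<close> (\<open>grows_like_by_comparison\<close>).

  Such a step function is built from an entire cutoff \<open>\<theta>\<close> that rises from \<open>0\<close> to \<open>1\<close> along the real
  axis: up to a constant factor, \<open>h(z) = (1 + e\<^sup>-\<^sup>z) exp(-4 \<Sum>\<^sub>k \<theta>(4\<^sup>k (z - l\<^sub>k)))\<close>. The cutoff is chosen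
  such that \<open>\<theta>'\<close> has positive real part in a whole strip about the real axis. Hence \<open>-h'/h\<close> has
  positive real part in discs about real points \<open>x \<ge> 0\<close> whose radius is at least a constant multiple of
  \<open>\<surd>h(x)\<close> (\<open>regular_ball\<close>), and by the Schwarz lemma it is almost constant in much smaller discs
  (\<open>regular_distortion\<close>). So \<open>h\<close> is almost exponential there. It follows that one application of \<open>f\<close>
  multiplies the imaginary part by about \<open>1 + h'(x)\<close>, while \<open>\<surd>h\<close> changes only by a factor
  of about \<open>1 + h'(x)/2\<close>; therefore the channel \<open>|Im z| < c \<surd>h(Re z)\<close> is mapped into itself (\<open>channel_step\<close>).
  In the channel all orbits escape to the right, uniformly, which puts it into the Fatou set.

  Let \<open>U\<close> be the Fatou component that contains the positive axis. The factor \<open>1 + e\<^sup>-\<^sup>z\<close> makes all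
  odd multiples of \<open>\<pi>i\<close> fixed points. Escape to infinity spreads over a Fatou component by
  a Harnack argument (\<open>fatou_component_escape\<close>), so \<open>U\<close> contains none of these fixed points, and
  the iterates restricted to \<open>U\<close> omit them. As they form an arithmetic progression, two of them
  always have a distance comparable to \<open>|f\<^sup>n(z)|\<close>; after rescaling, Schottky's theorem shows that
  \<open>|f\<^sup>n|\<close> is comparable at neighbouring points of \<open>U\<close>, uniformly in \<open>n\<close>. Thus the rate found on the real
  axis holds everywhere in \<open>U\<close> (\<open>baker_domain_of_escaping_region\<close>).
\<close>

section \<open>Functions with positive real part\<close>

text \<open>
  The quotient \<open>(w - F a) / (w + cnj (F a))\<close> maps the right half-plane to the unit disc and \<open>F a\<close>
  to zero, so the Schwarz lemma applies to its composition with \<open>F\<close>.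
\<close>
lemma Re_pos_distortion:
  fixes F :: "complex \<Rightarrow> complex"
  assumes holo: "F holomorphic_on ball a R" and "R > 0"
    and pos: "\<And>z. z \<in> ball a R \<Longrightarrow> Re (F z) > 0"
    and t: "dist a z \<le> t * R" "t < 1"
  shows "norm (F z - F a) \<le> 2 * t / (1 - t) * Re (F a)"
proof -
  define \<phi> where "\<phi> \<zeta> = (F (a + of_real R * \<zeta>) - F a) / (F (a + of_real R * \<zeta>) + cnj (F a))" for \<zeta>
  have inball: "a + of_real R * \<zeta> \<in> ball a R" if "norm \<zeta> < 1" for \<zeta>
    using that \<open>R > 0\<close> by (simp add: dist_norm norm_mult)
  have Fa: "Re (F a) > 0"
    using pos[of a] \<open>R > 0\<close> by simp
  have den: "F (a + of_real R * \<zeta>) + cnj (F a) \<noteq> 0" if "norm \<zeta> < 1" for \<zeta>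
    using pos[OF inball[OF that]] Fa by (auto simp: complex_eq_iff)
  have lt: "norm (F z - F a) < norm (F z + cnj (F a))" if "Re (F z) > 0" for z
  proof -
    have "(norm (F z + cnj (F a)))\<^sup>2 - (norm (F z - F a))\<^sup>2 = 4 * Re (F z) * Re (F a)"
      unfolding cmod_power2 by (simp add: power2_eq_square algebra_simps)
    also have "\<dots> > 0"
      using that Fa by simp
    finally show ?thesis
      by (simp add: power2_less_imp_less)
  qed
  obtain \<zeta> where \<zeta>: "z = a + of_real R * \<zeta>" "norm \<zeta> \<le> t"
  proof
    show "z = a + of_real R * ((z - a) / of_real R)"
      using \<open>R > 0\<close> by simp
    show "norm ((z - a) / of_real R) \<le> t"
      using t(1) \<open>R > 0\<close> by (simp add: norm_divide dist_norm norm_minus_commute field_simps)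
  qed
  have n\<zeta>: "norm \<zeta> < 1"
    using \<zeta> t by simp
  have "norm (\<phi> \<zeta>) \<le> norm \<zeta>"
  proof (rule Schwarz_Lemma(1)[OF _ _ _ n\<zeta>])
    have "(\<lambda>\<zeta>. F (a + of_real R * \<zeta>)) holomorphic_on ball 0 1"
      by (rule holomorphic_on_compose_gen[OF _ holo, unfolded o_def])
        (auto intro!: holomorphic_intros inball simp del: mem_ball)
    then show "\<phi> holomorphic_on ball 0 1"
      unfolding \<phi>_def by (intro holomorphic_intros den) auto
    show "\<phi> 0 = 0"
      by (simp add: \<phi>_def)
    show "norm (\<phi> \<xi>) < 1" if "norm \<xi> < 1" for \<xi>
      using lt[OF pos[OF inball[OF that]]] den[OF that]
      by (simp add: \<phi>_def norm_divide)
  qed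
  then have "norm (F z - F a) \<le> norm \<zeta> * norm (F z + cnj (F a))"
    using den[OF n\<zeta>] by (simp add: \<phi>_def norm_divide \<zeta>(1) field_simps)
  also have "\<dots> \<le> t * (norm (F z - F a) + 2 * Re (F a))"
  proof (rule mult_mono[OF \<zeta>(2)])
    have "F z + cnj (F a) = (F z - F a) + of_real (2 * Re (F a))"
      by (simp add: complex_eq_iff)
    then show "norm (F z + cnj (F a)) \<le> norm (F z - F a) + 2 * Re (F a)"
      using norm_triangle_ineq[of "F z - F a" "of_real (2 * Re (F a))"] Fa by (metis abs_of_pos mult_pos_pos norm_of_real zero_less_numeral)
    show "0 \<le> t"
      using \<zeta>(2) norm_ge_zero order_trans by blast
  qed auto
  finally show ?thesis
    using t(2) by (simp add: field_simps)
qed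

text \<open>
  Harnack's inequality for the positive harmonic function \<open>ln |G|\<close>, which is the real part of a
  branch of the logarithm of \<open>G\<close>.
\<close>
lemma norm_ge_1_distortion:
  assumes holo: "G holomorphic_on ball a r" and "r > 0"
    and big: "\<And>z. z \<in> ball a r \<Longrightarrow> norm (G z) > 1"
    and w: "dist a w \<le> r / 5"
  shows "norm (G a) \<le> (norm (G w))\<^sup>2"
proof -
  have "G z \<noteq> 0" if "z \<in> ball a r" for z
    using big[OF that] by auto
  then obtain l where l: "l holomorphic_on ball a r" "\<And>z. z \<in> ball a r \<Longrightarrow> G z = exp (l z)"
    using contractible_imp_holomorphic_log[OF holo] convex_imp_contractible convex_ball by metis
  have "norm (l w - l a) \<le> 2 * (1 / 5) / (1 - 1 / 5) * Re (l a)"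
  proof (rule Re_pos_distortion[OF l(1) \<open>r > 0\<close>])
    show "Re (l z) > 0" if "z \<in> ball a r" for z
      using big[OF that] l(2)[OF that] by simp
  qed (use w in auto)
  then have "Re (l a) \<le> 2 * Re (l w)"
    using abs_Re_le_cmod[of "l w - l a"] by simp
  moreover have "w \<in> ball a r" "a \<in> ball a r"
    using w \<open>r > 0\<close> by auto
  ultimately show ?thesis
    by (simp add: l(2) flip: exp_double)
qed

section \<open>Normality and escape to infinity\<close>

lemma snd_to_sphere: "snd (to_sphere z) = 1 - 2 / (1 + (cmod z)\<^sup>2)"
  by (simp add: to_sphere_def field_simps add_nonneg_eq_0_iff)

lemma dist_to_sphere_north_le:
  assumes "z \<noteq> 0"
  shows "dist (to_sphere z) (0, 1) \<le> 3 / cmod z"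
proof -
  define r where "r = cmod z"
  have r: "r > 0"
    using assms by (simp add: r_def)
  have pos: "1 + r\<^sup>2 > 0"
    by (simp add: add_pos_nonneg)
  have two: "1 + r\<^sup>2 \<ge> 2 * r"
    using sum_squares_bound[of 1 r] by simp
  have "dist (to_sphere z) (0, 1) \<le> norm (fst (to_sphere z)) + norm (snd (to_sphere z) - 1)"
    unfolding dist_prod_def dist_norm
    by (rule order_trans[OF sqrt_sum_squares_le_sum]) auto
  also have "norm (snd (to_sphere z) - 1) = 2 / (1 + r\<^sup>2)"
    using pos by (simp add: snd_to_sphere r_def)
  also have "norm (fst (to_sphere z)) = 2 * r / (1 + r\<^sup>2)"
    using pos by (simp add: to_sphere_def norm_divide norm_mult r_def del: of_real_add)
  also have "2 * r / (1 + r\<^sup>2) + 2 / (1 + r\<^sup>2) \<le> 2 / r + 1 / r"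
  proof (rule add_mono)
    show "2 * r / (1 + r\<^sup>2) \<le> 2 / r"
      using r pos by (simp add: field_simps power2_eq_square)
    show "2 / (1 + r\<^sup>2) \<le> 1 / r"
      using r pos two by (simp add: field_simps)
  qed
  finally show ?thesis
    by (simp add: r_def)
qed

lemma tendsto_north_iff:
  "((\<lambda>n. to_sphere (F n)) \<longlonglongrightarrow> (0, 1)) \<longleftrightarrow> filterlim F at_infinity sequentially"
proof
  assume "(\<lambda>n. to_sphere (F n)) \<longlonglongrightarrow> (0, 1)"
  then have lim: "(\<lambda>n. snd (to_sphere (F n))) \<longlonglongrightarrow> 1"
    using tendsto_snd by fastforce
  show "filterlim F at_infinity sequentially"
    unfolding filterlim_at_infinity[OF order_refl]
  proof (intro allI impI)
    fix K :: real
    assume "K > 0"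
    have "1 - 2 / (1 + K\<^sup>2) < 1"
      by (simp add: add_pos_nonneg)
    from order_tendstoD(1)[OF lim this]
    show "eventually (\<lambda>n. K \<le> norm (F n)) sequentially"
    proof eventually_elim
      case (elim n)
      then have "2 / (1 + (norm (F n))\<^sup>2) < 2 / (1 + K\<^sup>2)"
        by (simp add: snd_to_sphere)
      then have "K\<^sup>2 < (norm (F n))\<^sup>2"
        by (simp add: divide_simps add_pos_nonneg add_nonneg_eq_0_iff split: if_splits)
      then show ?case
        using power2_less_imp_less[of K "norm (F n)"] by simp
    qed
  qed
next
  assume lim: "filterlim F at_infinity sequentially"
  have ev: "eventually (\<lambda>n. dist (to_sphere (F n)) (0, 1) \<le> 3 / cmod (F n)) sequentially"
    using filterlim_at_infinity_imp_eventually_ne[OF lim, of 0]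
    by eventually_elim (rule dist_to_sphere_north_le)
  have "(\<lambda>n. 3 / cmod (F n)) \<longlonglongrightarrow> 0"
    using lim by (intro tendsto_divide_0[OF tendsto_const] filterlim_at_top_imp_at_infinity
        filterlim_at_infinity_imp_norm_at_top)
  then have "(\<lambda>n. dist (to_sphere (F n)) (0, 1)) \<longlonglongrightarrow> 0"
    by (rule Lim_null_comparison[rotated]) (use ev in simp)
  then show "(\<lambda>n. to_sphere (F n)) \<longlonglongrightarrow> (0, 1)"
    by (rule tendsto_dist_iff[THEN iffD2])
qed

lemma continuous_to_sphere: "continuous_on A to_sphere"
proof -
  have nz: "1 + (cmod z)\<^sup>2 \<noteq> 0" for z
    using add_pos_nonneg[of 1 "(cmod z)\<^sup>2"] by simp
  have nz': "complex_of_real (1 + (cmod z)\<^sup>2) \<noteq> 0" for z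
    unfolding of_real_eq_0_iff by (rule nz)
  show ?thesis
    unfolding to_sphere_def[abs_def]
    by (intro continuous_on_Pair continuous_on_divide continuous_on_of_real continuous_on_diff
        continuous_on_add continuous_on_mult continuous_on_power continuous_on_norm
        continuous_on_id continuous_on_const ballI nz nz')
qed

lemma holomorphic_funpow:
  assumes "f holomorphic_on UNIV"
  shows "(f ^^ n) holomorphic_on UNIV"
proof (induction n)
  case (Suc n)
  then show ?case
    using holomorphic_on_compose_gen[OF Suc assms] by (simp add: o_def)
qed (simp add: id_def)

text \<open>
  The set where a normal limit is infinite is closed because the limit is continuous. It is open
  because near such a point the functions eventually have modulus greater than \<open>1\<close>, and then
  Harnack's inequality carries the divergence from the point to a neighbourhood.
\<close>
lemma normal_limit_north_propagates:
  assumes V: "open V" "connected V"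
    and holo: "\<And>n. G n holomorphic_on V"
    and lim: "spherical_locally_uniform_limit V G g"
    and xy: "x \<in> V" "y \<in> V" "g x = (0, 1)"
  shows "g y = (0, 1)"
proof -
  have pt: "(\<lambda>n. to_sphere (G n w)) \<longlonglongrightarrow> g w" if "w \<in> V" for w
  proof -
    obtain W where "w \<in> W" "uniform_limit W (\<lambda>n w. to_sphere (G n w)) g sequentially"
      using lim \<open>w \<in> V\<close> unfolding spherical_locally_uniform_limit_def by blast
    then show ?thesis
      by (rule tendsto_uniform_limitI[rotated])
  qed
  show ?thesis
  proof (rule connected_induction_simple[where P = "\<lambda>v. g v = (0, 1)", OF V(2) xy(1,2,3)])
    fix a
    assume "a \<in> V"
    then obtain W where W: "open W" "a \<in> W" "W \<subseteq> V"
      and unif: "uniform_limit W (\<lambda>n w. to_sphere (G n w)) g sequentially"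
      using lim unfolding spherical_locally_uniform_limit_def by blast
    have cont: "continuous_on W g"
    proof (rule uniform_limit_theorem[OF _ unif])
      have "continuous_on W (G n)" for n
        using holo W(3) holomorphic_on_imp_continuous_on holomorphic_on_subset by blast
      then show "\<forall>\<^sub>F n in sequentially. continuous_on W (\<lambda>w. to_sphere (G n w))"
        by (intro always_eventually allI continuous_on_compose2[OF continuous_to_sphere[of UNIV]]) auto
    qed simp
    show "\<exists>T. openin (top_of_set V) T \<and> a \<in> T \<and> (\<forall>x\<in>T. \<forall>y\<in>T. g x = (0, 1) \<longrightarrow> g y = (0, 1))"
    proof (cases "g a = (0, 1)")
      case False
      have "open (W \<inter> g -` (- {(0, 1)}))"
        by (intro continuous_open_preimage cont W(1) open_Compl closed_singleton)
      also have "W \<inter> g -` (- {(0, 1)}) = {w \<in> W. g w \<noteq> (0, 1)}"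
        by auto
      finally have "open {w \<in> W. g w \<noteq> (0, 1)}" .
      then have "openin (top_of_set V) {w \<in> W. g w \<noteq> (0, 1)}"
        using W(3) V(1) by (subst openin_open_eq) auto
      then show ?thesis
        using W(2) False by (intro exI[of _ "{w \<in> W. g w \<noteq> (0, 1)}"]) auto
    next
      case True
      have "open (W \<inter> (\<lambda>w. snd (g w)) -` {1/2<..})"
        by (intro continuous_open_preimage continuous_on_snd cont W(1) open_greaterThan)
      moreover have "a \<in> W \<inter> (\<lambda>w. snd (g w)) -` {1/2<..}"
        using W(2) True by simp
      ultimately obtain r where r: "r > 0" "ball a r \<subseteq> W \<inter> (\<lambda>w. snd (g w)) -` {1/2<..}"
        using open_contains_ball by blast
      have ev: "\<forall>\<^sub>F n in sequentially. \<forall>w\<in>W. dist (to_sphere (G n w)) (g w) < 1 / 4"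
        using uniform_limitD[OF unif, of "1/4"] by simp
      have north: "g w = (0, 1)" if w: "w \<in> ball a (r / 5)" for w
      proof -
        have "filterlim (\<lambda>n. G n a) at_infinity sequentially"
          using pt[OF \<open>a \<in> V\<close>] True by (simp add: tendsto_north_iff)
        have "\<forall>\<^sub>F n in sequentially. norm (G n a) \<le> (norm (G n w))\<^sup>2"
          using ev
        proof eventually_elim
          case (elim n)
          show ?case
          proof (rule norm_ge_1_distortion[where r = r and G = "G n" and a = a and w = w])
            show "G n holomorphic_on ball a r"
              using holo[of n] by (rule holomorphic_on_subset) (use W(3) r(2) in blast)
            show "norm (G n z) > 1" if z: "z \<in> ball a r" for z
            proof -
              have "z \<in> W" "snd (g z) > 1 / 2"
                using r(2) z by auto
              moreover have "dist (snd (to_sphere (G n z))) (snd (g z)) < 1 / 4"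
                using elim \<open>z \<in> W\<close> dist_snd_le le_less_trans by blast
              ultimately have "snd (to_sphere (G n z)) > 0"
                unfolding dist_real_def by linarith
              then have "(norm (G n z))\<^sup>2 > 1"
                using add_pos_nonneg[of 1 "(norm (G n z))\<^sup>2"]
                by (simp add: snd_to_sphere field_simps)
              then show ?thesis
                using power2_less_imp_less[of 1 "norm (G n z)"] by simp
            qed
          qed (use r(1) w in auto)
        qed
        moreover have "filterlim (\<lambda>n. norm (G n a)) at_top sequentially"
          using \<open>filterlim (\<lambda>n. G n a) at_infinity sequentially\<close>
          by (rule filterlim_at_infinity_imp_norm_at_top)
        ultimately have top: "filterlim (\<lambda>n. (norm (G n w))\<^sup>2) at_top sequentially"
          by (rule filterlim_at_top_mono[rotated])
        have "filterlim (\<lambda>n. G n w) at_infinity sequentially"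
          unfolding filterlim_at_infinity[OF order_refl]
        proof (intro allI impI)
          fix K :: real
          assume "K > 0"
          have "\<forall>\<^sub>F n in sequentially. K\<^sup>2 \<le> (norm (G n w))\<^sup>2"
            using top by (simp add: filterlim_at_top)
          then show "\<forall>\<^sub>F n in sequentially. K \<le> norm (G n w)"
            by eventually_elim (rule power2_le_imp_le, auto)
        qed
        then have "(\<lambda>n. to_sphere (G n w)) \<longlonglongrightarrow> (0, 1)"
          by (simp add: tendsto_north_iff)
        moreover have "w \<in> V"
          using w r W(3) by (auto simp: subset_eq)
        ultimately show ?thesis
          using pt LIMSEQ_unique by blast
      qed
      have "ball a (r / 5) \<subseteq> V"
        using r W(3) by (auto simp: subset_eq)
      then have "openin (top_of_set V) (ball a (r / 5))"
        using V(1) by (subst openin_open_eq) auto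
      then show ?thesis
        using north r(1) by (intro exI[of _ "ball a (r / 5)"]) auto
    qed
  qed
qed

lemma fatou_setI:
  assumes "open V" "normal_family_on V (range (\<lambda>n. f ^^ n))"
  shows "V \<subseteq> fatou_set f"
proof
  show "z \<in> fatou_set f" if "z \<in> V" for z
    unfolding fatou_set_def using assms that by (intro CollectI exI[of _ V]) simp
qed

lemma open_fatou_set: "open (fatou_set f)"
proof (subst open_subopen, intro ballI)
  fix z
  assume "z \<in> fatou_set f"
  then obtain V where V: "open V" "z \<in> V" "normal_family_on V (range (\<lambda>n. f ^^ n))"
    unfolding fatou_set_def by blast
  then show "\<exists>T. open T \<and> z \<in> T \<and> T \<subseteq> fatou_set f"
    using fatou_setI[OF V(1,3)] by blast
qed

lemma normal_family_on_subset:
  assumes "normal_family_on V \<F>" "open W" "W \<subseteq> V"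
  shows "normal_family_on W \<F>"
  unfolding normal_family_on_def
proof (intro allI impI)
  fix F :: "nat \<Rightarrow> complex \<Rightarrow> complex"
  assume "range F \<subseteq> \<F>"
  then obtain r g where rg: "strict_mono r" "g ` V \<subseteq> riemann_sphere"
    "spherical_locally_uniform_limit V (F \<circ> r) g"
    using assms(1) unfolding normal_family_on_def by blast
  have "spherical_locally_uniform_limit W (F \<circ> r) g"
    unfolding spherical_locally_uniform_limit_def
  proof
    fix z
    assume "z \<in> W"
    then obtain T where "open T" "z \<in> T" "T \<subseteq> V"
      "uniform_limit T (\<lambda>n w. to_sphere ((F \<circ> r) n w)) g sequentially"
      using rg(3) assms(3) unfolding spherical_locally_uniform_limit_def by blast
    then show "\<exists>T. open T \<and> z \<in> T \<and> T \<subseteq> W \<and>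
        uniform_limit T (\<lambda>n w. to_sphere ((F \<circ> r) n w)) g sequentially"
      using \<open>z \<in> W\<close> assms(2)
      by (intro exI[of _ "T \<inter> W"]) (auto elim: uniform_limit_on_subset)
  qed
  then show "\<exists>r g. strict_mono r \<and> g ` W \<subseteq> riemann_sphere \<and>
      spherical_locally_uniform_limit W (F \<circ> r) g"
    using rg assms(3) by blast
qed

text \<open>
  A sequence of iterates either repeats one iterate infinitely often, or its exponents tend to
  infinity and the whole sequence converges to the point at infinity.
\<close>
lemma uniform_escape_imp_fatou:
  assumes "open V"
    and esc: "\<And>K. \<forall>\<^sub>F n in sequentially. \<forall>w\<in>V. K \<le> cmod ((f ^^ n) w)"
  shows "V \<subseteq> fatou_set f"
proof (rule fatou_setI[OF assms(1)])
  show "normal_family_on V (range (\<lambda>n. f ^^ n))"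
    unfolding normal_family_on_def
  proof (intro allI impI)
    fix F :: "nat \<Rightarrow> complex \<Rightarrow> complex"
    assume "range F \<subseteq> range (\<lambda>n. f ^^ n)"
    then have "\<forall>i. \<exists>m. F i = f ^^ m"
      by blast
    then obtain m where m: "\<And>i. F i = f ^^ m i"
      by metis
    show "\<exists>r g. strict_mono r \<and> g ` V \<subseteq> riemann_sphere \<and>
        spherical_locally_uniform_limit V (F \<circ> r) g"
    proof (cases "\<exists>N. infinite {i. m i = N}")
      case True
      then obtain N where N: "infinite {i. m i = N}"
        by blast
      define r where "r = enumerate {i. m i = N}"
      have "F (r n) = f ^^ N" for n
        using enumerate_in_set[OF N, of n] m by (simp add: r_def)
      then have "spherical_locally_uniform_limit V (F \<circ> r) (\<lambda>w. to_sphere ((f ^^ N) w))"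
        unfolding spherical_locally_uniform_limit_def using assms(1)
        by (auto intro!: exI[of _ V] uniform_limit_const)
      moreover have "strict_mono r"
        unfolding r_def by (rule strict_mono_enumerate[OF N])
      ultimately show ?thesis
        by (intro exI[of _ r] exI[of _ "\<lambda>w. to_sphere ((f ^^ N) w)"])
          (auto intro: to_sphere_in_riemann_sphere)
    next
      case False
      have lim: "filterlim m at_top sequentially"
        unfolding filterlim_at_top
      proof
        fix N
        have "{i. m i < N} = (\<Union>j<N. {i. m i = j})"
          by auto
        then have "finite {i. m i < N}"
          using False by simp
        then show "\<forall>\<^sub>F i in sequentially. N \<le> m i"
          unfolding eventually_cofinite[symmetric] cofinite_eq_sequentially[symmetric]
          by (simp add: eventually_cofinite not_le)
      qed
      have "uniform_limit V (\<lambda>n w. to_sphere (F n w)) (\<lambda>_. (0, 1)) sequentially"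
      proof (rule uniform_limitI)
        fix e :: real
        assume "e > 0"
        have "\<forall>\<^sub>F n in sequentially. \<forall>w\<in>V. 4 / e \<le> cmod ((f ^^ m n) w)"
          using esc lim by (rule eventually_compose_filterlim)
        then show "\<forall>\<^sub>F n in sequentially. \<forall>w\<in>V. dist (to_sphere (F n w)) (0, 1) < e"
        proof eventually_elim
          case (elim n)
          show ?case
          proof
            fix w
            assume "w \<in> V"
            then have big: "4 / e \<le> cmod (F n w)"
              using elim m by simp
            with \<open>e > 0\<close> have pos: "cmod (F n w) > 0"
              by (smt (verit) divide_pos_pos)
            then have "dist (to_sphere (F n w)) (0, 1) \<le> 3 / cmod (F n w)"
              by (intro dist_to_sphere_north_le) auto
            also have "\<dots> < 4 / cmod (F n w)"
              using pos by (intro divide_strict_right_mono) auto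
            also have "\<dots> \<le> e"
              using big pos \<open>e > 0\<close> by (simp add: field_simps)
            finally show "dist (to_sphere (F n w)) (0, 1) < e" .
          qed
        qed
      qed
      then have "spherical_locally_uniform_limit V (F \<circ> id) (\<lambda>_. (0, 1))"
        unfolding spherical_locally_uniform_limit_def using assms(1) by (auto intro!: exI[of _ V])
      moreover have "strict_mono (id :: nat \<Rightarrow> nat)"
        by (simp add: strict_mono_def)
      moreover have "(0, 1) \<in> riemann_sphere"
        by (simp add: riemann_sphere_def norm_prod_def)
      ultimately show ?thesis
        by (intro exI[of _ id] exI[of _ "\<lambda>_. (0, 1)"]) auto
    qed
  qed
qed

text \<open>
  A sequence of iterates near \<open>f z\<close>, composed with \<open>f\<close>, is a sequence of iterates near \<open>z\<close>. A limit of
  a subsequence of the latter factors through \<open>f\<close>, because its value at \<open>v\<close> depends on \<open>f v\<close> only,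
  and the images of open sets are open.
\<close>
lemma fatou_set_forward_invariant:
  assumes holo: "f holomorphic_on UNIV" and nc: "\<not> f constant_on UNIV"
    and z: "z \<in> fatou_set f"
  shows "f z \<in> fatou_set f"
proof -
  have open_image: "open (f ` W)" if "open W" for W
    using open_mapping_thm[OF holo _ _ that] nc by auto
  obtain V where V: "open V" "z \<in> V" "normal_family_on V (range (\<lambda>n. f ^^ n))"
    using z unfolding fatou_set_def by blast
  have "normal_family_on (f ` V) (range (\<lambda>n. f ^^ n))"
    unfolding normal_family_on_def
  proof (intro allI impI)
    fix F :: "nat \<Rightarrow> complex \<Rightarrow> complex"
    assume F: "range F \<subseteq> range (\<lambda>n. f ^^ n)"
    have "range (\<lambda>i. F i \<circ> f) \<subseteq> range (\<lambda>n. f ^^ n)"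
    proof
      fix G
      assume "G \<in> range (\<lambda>i. F i \<circ> f)"
      then obtain i where i: "G = F i \<circ> f"
        by blast
      obtain m where "F i = f ^^ m"
        using F by blast
      then have "G = f ^^ Suc m"
        using i by (simp only: funpow_Suc_right)
      then show "G \<in> range (\<lambda>n. f ^^ n)"
        by blast
    qed
    then obtain r g where rg: "strict_mono r" "g ` V \<subseteq> riemann_sphere"
      "spherical_locally_uniform_limit V ((\<lambda>i. F i \<circ> f) \<circ> r) g"
      using V(3) unfolding normal_family_on_def by blast
    define g' where "g' y = lim (\<lambda>n. to_sphere (F (r n) y))" for y
    have g': "g' (f v) = g v" if v: "v \<in> V" for v
    proof -
      obtain W where W: "v \<in> W" "uniform_limit W (\<lambda>n w. to_sphere (((\<lambda>i. F i \<circ> f) \<circ> r) n w)) g sequentially"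
        using rg(3) v unfolding spherical_locally_uniform_limit_def by blast
      have "(\<lambda>n. to_sphere (((\<lambda>i. F i \<circ> f) \<circ> r) n v)) \<longlonglongrightarrow> g v"
        using W(2,1) by (rule tendsto_uniform_limitI)
      then show ?thesis
        unfolding g'_def by (intro limI) simp
    qed
    have "spherical_locally_uniform_limit (f ` V) (F \<circ> r) g'"
      unfolding spherical_locally_uniform_limit_def
    proof
      fix y
      assume "y \<in> f ` V"
      then obtain v where v: "v \<in> V" "y = f v"
        by blast
      obtain W where W: "open W" "v \<in> W" "W \<subseteq> V"
        and unif: "uniform_limit W (\<lambda>n w. to_sphere (((\<lambda>i. F i \<circ> f) \<circ> r) n w)) g sequentially"
        using rg(3) v unfolding spherical_locally_uniform_limit_def by blast
      have "uniform_limit (f ` W) (\<lambda>n w. to_sphere ((F \<circ> r) n w)) g' sequentially"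
      proof (rule uniform_limitI)
        fix e :: real
        assume "e > 0"
        from uniform_limitD[OF unif this]
        show "\<forall>\<^sub>F n in sequentially. \<forall>x\<in>f ` W. dist (to_sphere ((F \<circ> r) n x)) (g' x) < e"
          by (rule eventually_mono) (use g' W(3) in auto)
      qed
      then show "\<exists>T. open T \<and> y \<in> T \<and> T \<subseteq> f ` V \<and>
          uniform_limit T (\<lambda>n w. to_sphere ((F \<circ> r) n w)) g' sequentially"
        using W v open_image by (intro exI[of _ "f ` W"]) auto
    qed
    moreover have "g' ` f ` V \<subseteq> riemann_sphere"
      using g' rg(2) by auto
    ultimately show "\<exists>r g. strict_mono r \<and> g ` f ` V \<subseteq> riemann_sphere \<and>
        spherical_locally_uniform_limit (f ` V) (F \<circ> r) g"
      using rg(1) by blast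
  qed
  then show ?thesis
    using fatou_setI[OF open_image[OF V(1)]] V(2) by blast
qed

lemma
  assumes "fatou_component f U"
  shows fatou_component_connected: "connected U"
    and fatou_component_open: "open U"
    and fatou_component_subset: "U \<subseteq> fatou_set f"
proof -
  have U: "U \<in> components (fatou_set f)"
    using assms by (simp add: fatou_component_def)
  show "connected U" "open U" "U \<subseteq> fatou_set f"
    using in_components_connected[OF U] open_components[OF open_fatou_set U]
      in_components_subset[OF U] .
qed

text \<open>
  If one point of a small ball in the Fatou set escapes while some iterates stay bounded at another
  one, a normal limit of these iterates is infinite at the first point and finite at the second.
\<close>
lemma fatou_component_escape:
  assumes holo: "f holomorphic_on UNIV"
    and U: "fatou_component f U" and xy: "x \<in> U" "y \<in> U"
    and esc: "filterlim (\<lambda>n. (f ^^ n) x) at_infinity sequentially"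
  shows "filterlim (\<lambda>n. (f ^^ n) y) at_infinity sequentially"
proof -
  have "connected U" "open U" "U \<subseteq> fatou_set f"
    using fatou_component_connected[OF U] fatou_component_open[OF U] fatou_component_subset[OF U] .
  show ?thesis
  proof (rule connected_induction_simple[where P = "\<lambda>x. filterlim (\<lambda>n. (f ^^ n) x) at_infinity sequentially",
        OF \<open>connected U\<close> xy esc])
    fix a
    assume "a \<in> U"
    then obtain V where V: "open V" "a \<in> V" "normal_family_on V (range (\<lambda>n. f ^^ n))"
      using \<open>U \<subseteq> fatou_set f\<close> unfolding fatou_set_def by blast
    then obtain r where r: "r > 0" "ball a r \<subseteq> V \<inter> U"
      using \<open>a \<in> U\<close> \<open>open U\<close> open_contains_ball[of "V \<inter> U"] by blast
    define B where "B = ball a r"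
    have B: "open B" "connected B" "B \<subseteq> U" "a \<in> B"
      and normal: "normal_family_on B (range (\<lambda>n. f ^^ n))"
      using r normal_family_on_subset[OF V(3)] by (auto simp: B_def)
    have "filterlim (\<lambda>n. (f ^^ n) v) at_infinity sequentially"
      if u: "u \<in> B" "filterlim (\<lambda>n. (f ^^ n) u) at_infinity sequentially" and v: "v \<in> B" for u v
    proof (rule ccontr)
      assume "\<not> ?thesis"
      then obtain K where "\<not> (\<forall>\<^sub>F n in sequentially. K \<le> norm ((f ^^ n) v))"
        unfolding filterlim_at_infinity[OF order_refl] by blast
      then have "\<exists>\<^sub>F n in sequentially. norm ((f ^^ n) v) < K"
        by (simp add: frequently_def not_less)
      then have inf: "infinite {n. norm ((f ^^ n) v) < K}"
        by (simp add: frequently_cofinite flip: cofinite_eq_sequentially)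
      define s where "s = enumerate {n. norm ((f ^^ n) v) < K}"
      have s: "strict_mono s" "\<And>n. norm ((f ^^ s n) v) < K"
        using enumerate_in_set[OF inf] strict_mono_enumerate[OF inf] by (auto simp: s_def)
      obtain r g where rg: "strict_mono r"
        and lim: "spherical_locally_uniform_limit B ((\<lambda>n. f ^^ s n) \<circ> r) g"
        using normal unfolding normal_family_on_def by (metis (no_types, lifting) image_subset_iff rangeI)
      have pt: "(\<lambda>n. to_sphere ((f ^^ s (r n)) w)) \<longlonglongrightarrow> g w" if w: "w \<in> B" for w
      proof -
        obtain W where W: "w \<in> W" "uniform_limit W (\<lambda>n w. to_sphere (((\<lambda>n. f ^^ s n) \<circ> r) n w)) g sequentially"
          using lim w unfolding spherical_locally_uniform_limit_def by blast
        have "(\<lambda>n. to_sphere (((\<lambda>n. f ^^ s n) \<circ> r) n w)) \<longlonglongrightarrow> g w"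
          using W(2,1) by (rule tendsto_uniform_limitI)
        then show ?thesis
          by simp
      qed
      have "filterlim (\<lambda>n. (f ^^ s (r n)) u) at_infinity sequentially"
        using filterlim_compose[OF u(2) filterlim_subseq[OF strict_mono_compose[OF s(1) rg]]] by simp
      then have "(\<lambda>n. to_sphere ((f ^^ s (r n)) u)) \<longlonglongrightarrow> (0, 1)"
        by (simp add: tendsto_north_iff)
      then have "g u = (0, 1)"
        using pt[OF u(1)] LIMSEQ_unique by blast
      then have "g v = (0, 1)"
        using normal_limit_north_propagates[OF B(1,2) _ lim u(1) v]
          holomorphic_on_subset[OF holomorphic_funpow[OF holo]] by simp
      then have "filterlim (\<lambda>n. (f ^^ s (r n)) v) at_infinity sequentially"
        using pt[OF v] tendsto_north_iff[of "\<lambda>n. (f ^^ s (r n)) v"] by simp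
      then have "\<forall>\<^sub>F n in sequentially. max K 1 \<le> norm ((f ^^ s (r n)) v)"
        unfolding filterlim_at_infinity[OF order_refl] by (auto elim!: allE[of _ "max K 1"])
      then obtain n where "K \<le> norm ((f ^^ s (r n)) v)"
        unfolding eventually_sequentially by auto
      then show False
        using s(2)[of "r n"] by simp
    qed
    moreover have "openin (top_of_set U) B"
      using B \<open>open U\<close> by (subst openin_open_eq) auto
    ultimately show "\<exists>T. openin (top_of_set U) T \<and> a \<in> T \<and>
        (\<forall>x\<in>T. \<forall>y\<in>T. filterlim (\<lambda>n. (f ^^ n) x) at_infinity sequentially \<longrightarrow>
          filterlim (\<lambda>n. (f ^^ n) y) at_infinity sequentially)"
      using B(4) by (intro exI[of _ B]) blast
  qed
qed

section \<open>Comparable escape rates in a Fatou component\<close>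

definition odd_pi_i :: "nat \<Rightarrow> complex" where
  "odd_pi_i k = \<i> * of_real (pi * (2 * real k + 1))"

text \<open>
  The bound in Schottky's theorem for functions of modulus at most \<open>1\<close> at the centre of the unit
  disc, taken on the disc of radius \<open>1/2\<close>.
\<close>
definition distortion_const :: real where
  "distortion_const = exp (pi * exp (pi * (2 + 2 * 1 + 12 * (1 / 2) / (1 - 1 / 2))))"

lemma distortion_const_ge_1: "distortion_const \<ge> 1"
  by (simp add: distortion_const_def)

text \<open>
  Among the omitted values, \<open>\<pi>i\<close> and \<open>\<pi>i (2K+1)\<close> are moved to \<open>0\<close> and \<open>1\<close> by an affine map. With \<open>2\<pi>K\<close>
  comparable to \<open>|F w|\<close> the normalised function has modulus at most \<open>1\<close> at the centre, so Schottky's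
  theorem gives a bound that is linear in \<open>|F w|\<close>. Two fixed omitted values would give only
  a power of \<open>|F w|\<close>.
\<close>
lemma omit_odd_pi_i_distortion:
  assumes holo: "F holomorphic_on ball z r" and "r > 0"
    and omit: "\<And>v k. v \<in> ball z r \<Longrightarrow> F v \<noteq> odd_pi_i k"
    and w: "w \<in> ball z (r / 8)" and w': "w' \<in> ball z (r / 8)"
  shows "cmod (F w') \<le> distortion_const * (cmod (F w) + 20)"
proof -
  \<comment> \<open>Large enough for the normalised function to have modulus at most \<open>1\<close> at the centre, and
    still at most \<open>|F w|/(2\<pi>) + 3/2\<close>.\<close>
  define K where "K = nat \<lceil>(cmod (F w) + pi) / (2 * pi)\<rceil>"
  have ceil: "(cmod (F w) + pi) / (2 * pi) > 0"
    using pi_gt_zero by (intro divide_pos_pos add_nonneg_pos) auto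
  have K: "real K \<ge> (cmod (F w) + pi) / (2 * pi)" "real K \<le> (cmod (F w) + pi) / (2 * pi) + 1"
    unfolding K_def using ceil by linarith+
  define M where "M = 2 * pi * real K"
  have M: "cmod (F w) + pi \<le> M" "M \<le> cmod (F w) + 3 * pi"
    using K pi_gt_zero by (simp_all add: M_def field_simps)
  have Mpos: "M > 0"
    using M(1) pi_gt_zero norm_ge_zero[of "F w"] by linarith
  define \<phi> where "\<phi> \<zeta> = (F (w + of_real (r / 2) * \<zeta>) - odd_pi_i 0) / (\<i> * of_real M)" for \<zeta>
  have inball: "w + of_real (r / 2) * \<zeta> \<in> ball z r" if "norm \<zeta> \<le> 1" for \<zeta>
  proof -
    have "dist z (w + of_real (r / 2) * \<zeta>) \<le> dist z w + norm (of_real (r / 2) * \<zeta>)"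
      by (metis dist_triangle dist_norm add_diff_cancel_left' dist_commute)
    also have "norm (of_real (r / 2) * \<zeta>) \<le> r / 2"
      using that \<open>r > 0\<close> by (simp add: norm_mult mult_left_le)
    finally show ?thesis
      using w \<open>r > 0\<close> by simp
  qed
  define \<zeta> where "\<zeta> = (w' - w) / of_real (r / 2)"
  have n\<zeta>: "norm \<zeta> \<le> 1 / 2"
  proof -
    have "norm (w' - w) \<le> r / 8 + r / 8"
      using w w' dist_triangle3[of w' w z] by (simp add: dist_norm)
    moreover have "norm \<zeta> = norm (w' - w) / (r / 2)"
      unfolding \<zeta>_def norm_divide using \<open>r > 0\<close> by simp
    ultimately show ?thesis
      using \<open>r > 0\<close> by (simp add: pos_divide_le_eq)
  qed
  have "norm (\<phi> \<zeta>) \<le> distortion_const"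
    unfolding distortion_const_def
  proof (rule Schottky[where f = \<phi> and z = \<zeta> and r = 1 and t = "1 / 2"])
    have "(\<lambda>\<zeta>. w + of_real (r / 2) * \<zeta>) ` cball 0 1 \<subseteq> ball z r"
      by (intro image_subsetI inball) simp
    then have "(\<lambda>\<zeta>. F (w + of_real (r / 2) * \<zeta>)) holomorphic_on cball 0 1"
      by (intro holomorphic_on_compose_gen[OF _ holo, unfolded o_def] holomorphic_intros)
    then show "\<phi> holomorphic_on cball 0 1"
      unfolding \<phi>_def using Mpos by (intro holomorphic_intros) auto
    have "norm (F w - odd_pi_i 0) \<le> norm (F w) + pi"
      using norm_triangle_ineq4[of "F w" "odd_pi_i 0"] by (simp add: odd_pi_i_def norm_mult)
    then show "norm (\<phi> 0) \<le> 1"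
      using Mpos M(1) by (simp add: \<phi>_def norm_divide norm_mult)
    show "\<not> (\<phi> \<xi> = 0 \<or> \<phi> \<xi> = 1)" if "\<xi> \<in> cball 0 1" for \<xi>
    proof -
      have "F (w + of_real (r / 2) * \<xi>) \<noteq> odd_pi_i 0" "F (w + of_real (r / 2) * \<xi>) \<noteq> odd_pi_i K"
        using omit inball[of \<xi>] that by auto
      moreover have "odd_pi_i K = odd_pi_i 0 + \<i> * of_real M"
        by (simp add: M_def odd_pi_i_def algebra_simps)
      ultimately show ?thesis
        using Mpos by (auto simp: \<phi>_def divide_eq_eq diff_eq_eq add.commute simp del: of_real_mult)
    qed
  qed (use n\<zeta> in auto)
  moreover have "F w' = odd_pi_i 0 + \<i> * of_real M * \<phi> \<zeta>"
  proof -
    have "w + of_real (r / 2) * \<zeta> = w'"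
      using \<open>r > 0\<close> by (simp add: \<zeta>_def del: of_real_divide)
    then show ?thesis
      unfolding \<phi>_def using Mpos by simp
  qed
  moreover have "norm (odd_pi_i 0) = pi" "norm (\<i> * of_real M * \<phi> \<zeta>) = M * norm (\<phi> \<zeta>)"
    using Mpos by (simp_all add: odd_pi_i_def norm_mult)
  moreover have "M * norm (\<phi> \<zeta>) \<le> M * distortion_const"
    using \<open>norm (\<phi> \<zeta>) \<le> distortion_const\<close> Mpos by (intro mult_left_mono) auto
  ultimately have "norm (F w') \<le> pi + M * distortion_const"
    using norm_triangle_ineq[of "odd_pi_i 0" "\<i> * of_real M * \<phi> \<zeta>"] by simp
  also have "\<dots> \<le> pi * distortion_const + (cmod (F w) + 3 * pi) * distortion_const"
    using distortion_const_ge_1 M(2) pi_gt_zero by (intro add_mono mult_right_mono) auto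
  also have "\<dots> = distortion_const * (cmod (F w) + 4 * pi)"
    by (simp add: algebra_simps)
  also have "\<dots> \<le> distortion_const * (cmod (F w) + 20)"
    using distortion_const_ge_1 pi_less_4 by (intro mult_left_mono) auto
  finally show ?thesis .
qed

definition grows_like :: "(nat \<Rightarrow> real) \<Rightarrow> (nat \<Rightarrow> real) \<Rightarrow> bool" where
  "grows_like a x \<longleftrightarrow> (\<exists>C>1. \<exists>N. \<forall>n\<ge>N. a n / C \<le> x n \<and> x n \<le> C * a n)"

lemma grows_like_transfer:
  assumes a: "filterlim a at_top sequentially" and "grows_like a x" and C: "C \<ge> 1"
    and xy: "\<And>n. y n \<le> C * (x n + 20)" "\<And>n. x n \<le> C * (y n + 20)"
  shows "grows_like a y"
proof -
  obtain D N where D: "D > 1" and N: "\<And>n. n \<ge> N \<Longrightarrow> a n / D \<le> x n \<and> x n \<le> D * a n"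
    using assms(2) unfolding grows_like_def by blast
  have "\<forall>\<^sub>F n in sequentially. 40 * D * C \<le> a n"
    using a by (simp add: filterlim_at_top)
  then obtain N' where N': "\<And>n. n \<ge> N' \<Longrightarrow> 40 * D * C \<le> a n"
    unfolding eventually_sequentially by blast
  have DC: "D * C \<ge> 1"
    using D C mult_mono[of 1 D 1 C] by simp
  define E where "E = 2 * D * C + 20 * C"
  have E: "E > 1" "2 * D * C \<le> E" "C * D + 20 * C \<le> E"
    using D C DC by (simp_all add: E_def algebra_simps)
  have "a n / E \<le> y n \<and> y n \<le> E * a n" if n: "n \<ge> max N N'" for n
  proof
    have an: "40 * D * C \<le> a n" "a n / D \<le> x n" "x n \<le> D * a n"
      using N[of n] N'[of n] n by auto
    have an1: "a n \<ge> 1"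
      using an(1) DC by simp
    have "y n \<le> C * (D * a n + 20 * a n)"
      using xy(1)[of n] an an1 C by (smt (verit) mult_left_mono)
    also have "\<dots> = (C * D + 20 * C) * a n"
      by (simp add: algebra_simps)
    also have "\<dots> \<le> E * a n"
      using E(3) an1 by (intro mult_right_mono) auto
    finally show "y n \<le> E * a n" .
    have "a n / D \<le> C * (y n + 20)"
      using xy(2)[of n] an(2) by simp
    then have upper: "a n / (D * C) \<le> y n + 20"
      using C D by (simp add: field_simps)
    define X where "X = a n / (2 * D * C)"
    have "20 \<le> X"
      using an(1) C D by (simp add: X_def field_simps)
    moreover have "a n / (D * C) = 2 * X"
      by (simp add: X_def)
    ultimately have "a n / (2 * D * C) \<le> y n"
      using upper unfolding X_def[symmetric] by linarith
    moreover have "a n / E \<le> a n / (2 * D * C)"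
    proof (rule divide_left_mono[OF E(2)])
      show "0 < E * (2 * D * C)"
        using E(1) C D by (intro mult_pos_pos) auto
    qed (use an1 in auto)
    ultimately show "a n / E \<le> y n"
      by linarith
  qed
  then show ?thesis
    unfolding grows_like_def using E(1) by blast
qed

text \<open>
  The set \<open>L\<close> serves to show that the component \<open>U\<close> of \<open>p\<close> is invariant: \<open>U\<close> contains \<open>L\<close>, and \<open>f(U)\<close>
  meets \<open>U\<close> in \<open>f(p)\<close>. The function \<open>f\<close> is not a polynomial because it has infinitely many fixed points
  and is not the identity.
\<close>
theorem baker_domain_of_escaping_region:
  fixes a :: "nat \<Rightarrow> real"
  assumes holo: "f holomorphic_on UNIV"
    and fixed: "\<And>k. f (odd_pi_i k) = odd_pi_i k"
    and "open D"
    and esc: "\<And>K. \<forall>\<^sub>F n in sequentially. \<forall>w\<in>D. K \<le> cmod ((f ^^ n) w)"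
    and L: "connected L" "L \<subseteq> D" "f ` L \<subseteq> L" "p \<in> L"
    and a: "filterlim a at_top sequentially"
    and rate: "grows_like a (\<lambda>n. cmod ((f ^^ n) p))"
  obtains U where "transcendental_entire f" "baker_domain f U"
    "\<And>z. z \<in> U \<Longrightarrow> grows_like a (\<lambda>n. cmod ((f ^^ n) z))"
proof -
  have esc_p: "filterlim (\<lambda>n. (f ^^ n) w) at_infinity sequentially" if "w \<in> D" for w
    unfolding filterlim_at_infinity[OF order_refl]
  proof (intro allI impI)
    show "\<forall>\<^sub>F n in sequentially. K \<le> norm ((f ^^ n) w)" for K
      using esc[of K] by eventually_elim (use that in auto)
  qed
  have iter_fixed: "(f ^^ n) (odd_pi_i k) = odd_pi_i k" for n k
    by (induction n) (auto simp: fixed)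
  have not_id: "f p \<noteq> p"
  proof
    assume "f p = p"
    then have "(f ^^ n) p = p" for n
      by (induction n) auto
    moreover have "\<forall>\<^sub>F n in sequentially. cmod p + 1 \<le> cmod ((f ^^ n) p)"
      using esc[of "cmod p + 1"] by eventually_elim (use L in auto)
    ultimately show False
      by (auto simp: eventually_sequentially)
  qed
  have inj: "inj odd_pi_i"
    by (auto simp: inj_on_def odd_pi_i_def simp del: of_real_mult)
  have transc: "transcendental_entire f"
    unfolding transcendental_entire_def
  proof (intro conjI holo notI)
    assume "\<exists>q. f = poly q"
    then obtain q where q: "f = poly q"
      by blast
    have "range odd_pi_i \<subseteq> {z. poly (q - [:0, 1:]) z = 0}"
      using fixed by (auto simp: q)
    then have "infinite {z. poly (q - [:0, 1:]) z = 0}"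
      using range_inj_infinite[OF inj] finite_subset by blast
    then have "q - [:0, 1:] = 0"
      using poly_roots_finite by blast
    then have "f p = p"
      by (simp add: q)
    with not_id show False ..
  qed
  have nc: "\<not> f constant_on UNIV"
  proof
    assume "f constant_on UNIV"
    then have "odd_pi_i 0 = odd_pi_i 1"
      using fixed[of 0] fixed[of 1] unfolding constant_on_def by (metis UNIV_I)
    then show False
      using inj by (metis injD zero_neq_one)
  qed
  have "D \<subseteq> fatou_set f"
    using uniform_escape_imp_fatou[OF \<open>open D\<close> esc] .
  then have LF: "L \<subseteq> fatou_set f"
    using L(2) by blast
  define U where "U = connected_component_set (fatou_set f) p"
  have U: "fatou_component f U"
    unfolding fatou_component_def U_def using LF L(4) by (auto simp: components_def)
  have "connected U" "open U" "U \<subseteq> fatou_set f"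
    using fatou_component_connected[OF U] fatou_component_open[OF U] fatou_component_subset[OF U] .
  have LU: "L \<subseteq> U"
    unfolding U_def using connected_component_maximal[OF L(4,1) LF] .
  have fU: "f ` U \<subseteq> U"
  proof -
    have "connected (f ` U)"
      using \<open>connected U\<close> holo holomorphic_on_imp_continuous_on
      by (intro connected_continuous_image) (auto intro: continuous_on_subset)
    moreover have "f ` U \<subseteq> fatou_set f"
      using \<open>U \<subseteq> fatou_set f\<close> fatou_set_forward_invariant[OF holo nc] by blast
    moreover have "f p \<in> f ` U" "f p \<in> U"
      using LU L by blast+
    moreover have "U = connected_component_set (fatou_set f) (f p)"
      using \<open>f p \<in> U\<close> unfolding U_def by (metis connected_component_eq)
    ultimately show ?thesis
      using connected_component_maximal by metis
  qed
  have iterU: "(f ^^ n) z \<in> U" if "z \<in> U" for n z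
    using that fU by (induction n) auto
  have escU: "filterlim (\<lambda>n. (f ^^ n) z) at_infinity sequentially" if "z \<in> U" for z
    using fatou_component_escape[OF holo U _ that esc_p] LU L by blast
  have omit: "odd_pi_i k \<notin> U" for k
  proof
    assume "odd_pi_i k \<in> U"
    then have "filterlim (\<lambda>n::nat. odd_pi_i k) at_infinity sequentially"
      using escU[of "odd_pi_i k"] by (simp only: iter_fixed)
    then have "filterlim (\<lambda>n::nat. norm (odd_pi_i k)) at_top sequentially"
      by (rule filterlim_at_infinity_imp_norm_at_top)
    then show False
      using filterlim_at_top_dense[of "\<lambda>n::nat. norm (odd_pi_i k)" sequentially] by auto
  qed
  have "baker_domain f U"
    unfolding baker_domain_def periodic_fatou_component_def fatou_component_image_def
    using U fU escU by (auto intro!: exI[of _ 1])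
  moreover have "grows_like a (\<lambda>n. cmod ((f ^^ n) z))" if "z \<in> U" for z
  proof -
    have "p \<in> U"
      using LU L by blast
    show ?thesis
    proof (rule connected_induction_simple[where P = "\<lambda>z. grows_like a (\<lambda>n. cmod ((f ^^ n) z))",
          OF \<open>connected U\<close> \<open>p \<in> U\<close> \<open>z \<in> U\<close> rate])
      fix c
      assume "c \<in> U"
      then obtain r where r: "r > 0" "ball c r \<subseteq> U"
        using \<open>open U\<close> open_contains_ball by blast
      have le: "cmod ((f ^^ n) w') \<le> distortion_const * (cmod ((f ^^ n) w) + 20)"
        if "w \<in> ball c (r / 8)" "w' \<in> ball c (r / 8)" for n w w'
      proof (rule omit_odd_pi_i_distortion[OF _ r(1) _ that])
        show "(f ^^ n) holomorphic_on ball c r"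
          using holomorphic_funpow[OF holo] holomorphic_on_subset by blast
        show "(f ^^ n) v \<noteq> odd_pi_i k" if "v \<in> ball c r" for v k
          using iterU[of v n] omit[of k] that r(2) by auto
      qed
      have "openin (top_of_set U) (ball c (r / 8))"
        using r \<open>open U\<close> by (subst openin_open_eq) (auto simp: subset_eq)
      moreover have transfer: "grows_like a (\<lambda>n. cmod ((f ^^ n) w'))"
        if "w \<in> ball c (r / 8)" "w' \<in> ball c (r / 8)" "grows_like a (\<lambda>n. cmod ((f ^^ n) w))" for w w'
        by (rule grows_like_transfer[OF a that(3) distortion_const_ge_1]) (intro le that)+
      ultimately show "\<exists>T. openin (top_of_set U) T \<and> c \<in> T \<and> (\<forall>x\<in>T. \<forall>y\<in>T.
          grows_like a (\<lambda>n. cmod ((f ^^ n) x)) \<longrightarrow> grows_like a (\<lambda>n. cmod ((f ^^ n) y)))"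
        using r(1) by (intro exI[of _ "ball c (r / 8)"] conjI ballI impI)
          (assumption | rule transfer | simp)+
    qed
  qed
  ultimately show ?thesis
    by (rule that[OF transc])
qed

section \<open>An entire cutoff function\<close>

text \<open>
  With \<open>w = e\<^sup>s\<close> this is \<open>1 - (1 - e\<^sup>-\<^sup>w) / w\<close>, which is \<open>1 - \<integral>\<^sub>0\<^sup>1 e\<^sup>-\<^sup>t\<^sup>w dt\<close>. It is close to \<open>0\<close> on the left and,
  in a horizontal strip about the real axis, close to \<open>1\<close> on the right. The simpler function
  \<open>1 - e\<^sup>-\<^sup>w\<close> would not do: off the real axis its derivative \<open>w e\<^sup>-\<^sup>w\<close> oscillates for large \<open>w\<close>. The
  average over \<open>t\<close> removes the oscillation at the price of a slower decay.
\<close>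
definition cutoff :: "complex \<Rightarrow> complex" where
  "cutoff s = 1 - (1 - exp (- exp s)) * exp (- s)"

definition cutoff' :: "complex \<Rightarrow> complex" where
  "cutoff' s = exp (- s) - exp (- exp s) * (1 + exp (- s))"

lemma has_field_derivative_cutoff: "(cutoff has_field_derivative cutoff' s) (at s)"
  unfolding cutoff_def[abs_def] cutoff'_def
  by (rule derivative_eq_intros refl | simp)+ (simp add: algebra_simps flip: exp_add)

lemma cutoff_of_exp: "cutoff s = (exp (- exp s) - 1 + exp s) / exp s"
  by (simp add: cutoff_def exp_minus field_simps)

lemma cutoff'_of_exp: "cutoff' s = (1 - (1 + exp s) * exp (- exp s)) / exp s"
  by (simp add: cutoff'_def exp_minus field_simps)

lemma exp_gt_cubic:
  fixes u :: real
  assumes "u > 0"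
  shows "1 + u + u ^ 3 / 6 < exp u"
proof -
  have "1 + u / 2 + (u / 2)\<^sup>2 / 2 \<le> exp (u / 2)"
    using exp_lower_Taylor_quadratic[of "u / 2"] assms by simp
  then have "(1 + u / 2 + (u / 2)\<^sup>2 / 2)\<^sup>2 \<le> (exp (u / 2))\<^sup>2"
    using assms by (intro power_mono) auto
  also have "(exp (u / 2))\<^sup>2 = exp u"
    by (simp flip: exp_double)
  also have "(1 + u / 2 + (u / 2)\<^sup>2 / 2)\<^sup>2
      = 1 + u + u ^ 3 / 6 + u\<^sup>2 * ((u / 8 - 1 / 6)\<^sup>2 + 17 / 36)"
    by (simp add: power2_eq_square power3_eq_cube field_simps)
  finally show ?thesis
    using assms by (smt (verit) zero_less_power mult_pos_pos zero_le_power2 divide_pos_pos)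
qed

text \<open>
  The Taylor bound \<open>sin v \<ge> v - v\<^sup>3/6\<close> for \<open>v \<ge> 0\<close>, multiplied by \<open>v\<close> so that it holds for both signs.
\<close>
lemma mult_sin_ge:
  fixes v :: real
  shows "v\<^sup>2 - v ^ 4 / 6 \<le> v * sin v"
proof -
  have pos: "v\<^sup>2 - v ^ 4 / 6 \<le> v * sin v" if "v \<ge> 0" for v :: real
  proof -
    have "\<bar>sin v - v\<bar> \<le> v ^ 3 / 6"
      using Maclaurin_sin_bound[of v 3] that
      by (simp add: eval_nat_numeral sin_coeff_def field_simps)
    then have "v - v ^ 3 / 6 \<le> sin v"
      by linarith
    then have "v * (v - v ^ 3 / 6) \<le> v * sin v"
      using that by (rule mult_left_mono)
    then show ?thesis
      by (simp add: power2_eq_square power3_eq_cube power4_eq_xxxx algebra_simps)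
  qed
  show ?thesis
    using pos[of v] pos[of "- v"] by (cases "v \<ge> 0") auto
qed

lemma Re_Im_exp_narrow:
  assumes "\<bar>Im s\<bar> \<le> 1 / 2"
  shows "\<bar>Im (exp s)\<bar> \<le> Re (exp s)" and "Re (exp s) \<ge> 7 / 8 * exp (Re s)"
proof -
  have c: "cos (Im s) \<ge> 1 - (1/2)\<^sup>2 / 2"
  proof -
    have "(sin (Im s / 2))\<^sup>2 \<le> (1 / 4)\<^sup>2"
      using assms abs_sin_x_le_abs_x[of "Im s / 2"] by (intro abs_le_square_iff[THEN iffD1]) simp
    moreover have "cos (Im s) = 1 - 2 * (sin (Im s / 2))\<^sup>2"
      using cos_double_sin[of "Im s / 2"] by simp
    ultimately show ?thesis
      by (simp add: power2_eq_square)
  qed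
  have "\<bar>sin (Im s)\<bar> \<le> 1 / 2"
    using assms abs_sin_x_le_abs_x order_trans by blast
  with c show "\<bar>Im (exp s)\<bar> \<le> Re (exp s)"
    by (simp add: Im_exp Re_exp abs_mult power2_eq_square)
  show "Re (exp s) \<ge> 7 / 8 * exp (Re s)"
    using c by (simp add: Re_exp power2_eq_square)
qed

text \<open>
  With \<open>w = e\<^sup>s = u + iv\<close> the claim is \<open>(u + u\<^sup>2 + v\<^sup>2) cos v - v sin v < u e\<^sup>u\<close>, where \<open>|v| \<le> u\<close> by the
  choice of the strip. The term \<open>v sin v\<close> absorbs \<open>v\<^sup>2\<close> up to \<open>v\<^sup>4/6\<close>, and what remains is dominated by
  the Taylor series of \<open>u e\<^sup>u\<close>.
\<close>
lemma Re_cutoff'_pos: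
  assumes "\<bar>Im s\<bar> \<le> 1 / 2"
  shows "Re (cutoff' s) > 0"
proof -
  define w where "w = exp s"
  define u v where "u = Re w" and "v = Im w"
  have vu: "\<bar>v\<bar> \<le> u" and u0: "u > 0"
    using Re_Im_exp_narrow[OF assms] unfolding u_def v_def w_def
     apply auto
    by (smt (verit) exp_gt_zero)
  have v4: "v ^ 4 \<le> u ^ 4"
    using power_mono[OF vu, of 4] by simp
  have "(u + u\<^sup>2 + v\<^sup>2) * cos v - v * sin v \<le> (u + u\<^sup>2 + v\<^sup>2) * 1 - v * sin v"
    using u0 by (intro diff_right_mono mult_left_mono) auto
  also have "\<dots> \<le> u + u\<^sup>2 + u ^ 4 / 6"
    using mult_sin_ge[of v] v4 by simp
  also have "\<dots> = u * (1 + u + u ^ 3 / 6)"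
    by (simp add: power2_eq_square power3_eq_cube power4_eq_xxxx algebra_simps)
  also have "\<dots> < u * exp u"
    using exp_gt_cubic[OF u0] u0 by simp
  finally have "((u + u\<^sup>2 + v\<^sup>2) * cos v - v * sin v) * exp (- u) < u"
    by (simp add: exp_minus field_simps)
  moreover have "Re ((1 - (1 + w) * exp (- w)) * cnj w)
      = u - ((u + u\<^sup>2 + v\<^sup>2) * cos v - v * sin v) * exp (- u)"
    by (simp add: u_def v_def Re_exp Im_exp power2_eq_square algebra_simps)
  ultimately have "Re ((1 - (1 + w) * exp (- w)) * cnj w) > 0"
    by simp
  moreover have "w \<noteq> 0"
    using u0 by (auto simp: u_def)
  ultimately show ?thesis
    unfolding cutoff'_of_exp w_def[symmetric] complex_div_cnj[of _ w]
    by (simp flip: of_real_power)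
qed

lemma norm_exp_minus_quadratic_le:
  fixes w :: complex
  assumes "norm w \<le> 1 / 4"
  shows "norm (exp (- w) - (1 - w + w\<^sup>2 / 2)) \<le> 7 / 10 * norm w ^ 3"
proof -
  have "norm (exp (- w) - (\<Sum>k\<le>2. (- w) ^ k / fact k)) \<le> exp \<bar>Re (- w)\<bar> * norm (- w) ^ 3 / 2"
    using Taylor_exp[of "- w" 2] by (simp add: eval_nat_numeral)
  also have "\<dots> \<le> 7 / 5 * norm (- w) ^ 3 / 2"
  proof (intro divide_right_mono mult_right_mono)
    have "exp \<bar>Re (- w)\<bar> \<le> exp (1 / 4)"
      using assms abs_Re_le_cmod[of w] by simp
    also have "\<dots> \<le> 1 + 1/4 + (1/4)\<^sup>2"
      by (rule exp_bound) auto
    finally show "exp \<bar>Re (- w)\<bar> \<le> 7 / 5"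
      by (simp add: power2_eq_square)
  qed auto
  finally show ?thesis
    by (simp add: eval_nat_numeral field_simps)
qed

text \<open>
  Far to the left the derivative is \<open>w/2\<close> with \<open>w = e\<^sup>s\<close>, up to an error of order \<open>w\<^sup>2\<close>.
\<close>
lemma
  assumes "Re s \<le> - 2"
  shows norm_cutoff'_le: "norm (cutoff' s) \<le> exp (Re s)"
    and Re_cutoff'_ge: "\<bar>Im s\<bar> \<le> 1 / 2 \<Longrightarrow> Re (cutoff' s) \<ge> exp (Re s) / 8"
proof -
  define w where "w = exp s"
  define \<rho> where "\<rho> = exp (- w) - (1 - w + w\<^sup>2 / 2)"
  have nw: "norm w = exp (Re s)" and w0: "w \<noteq> 0"
    by (auto simp: w_def)
  have "exp (Re s) \<le> exp (- 2)"
    using assms by simp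
  also have "exp (- 2) \<le> (1 / 5 :: real)"
    using exp_lower_Taylor_quadratic[of 2] by (simp add: exp_minus field_simps)
  finally have w5: "norm w \<le> 1 / 5"
    by (simp add: nw)
  have \<rho>: "norm \<rho> \<le> 7 / 10 * norm w ^ 3"
    unfolding \<rho>_def using w5 by (intro norm_exp_minus_quadratic_le) simp
  have "cutoff' s = (1 - (1 + w) * (\<rho> + (1 - w + w\<^sup>2 / 2))) / w"
    by (simp add: cutoff'_of_exp \<rho>_def w_def)
  also have "\<dots> = w / 2 - (w\<^sup>2 / 2 + (1 + w) * \<rho> / w)"
    using w0 by (simp add: field_simps power2_eq_square)
  finally have eq: "cutoff' s = w / 2 - (w\<^sup>2 / 2 + (1 + w) * \<rho> / w)" .
  have "norm (w\<^sup>2 / 2 + (1 + w) * \<rho> / w) \<le> norm w * norm w / 2 + norm (1 + w) * norm \<rho> / norm w"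
    by (rule order_trans[OF norm_triangle_ineq])
      (simp add: norm_mult norm_divide norm_power power2_eq_square)
  also have "norm (1 + w) * norm \<rho> / norm w \<le> (6 / 5) * (7 / 10 * norm w ^ 3) / norm w"
    using w5 norm_triangle_ineq[of 1 w] by (intro divide_right_mono mult_mono \<rho>) auto
  also have "\<dots> = norm w * norm w * (42 / 50)"
    using w0 by (simp add: power3_eq_cube field_simps)
  also have "norm w * norm w / 2 + norm w * norm w * (42 / 50) \<le> norm w * (3 / 10)"
  proof -
    have "norm w * norm w \<le> norm w * (1 / 5)"
      using w5 by (intro mult_left_mono) auto
    moreover have "A / 2 + A * (42 / 50) \<le> B * (3 / 10)" if "A \<le> B * (1 / 5)" "0 \<le> B" for A B :: real
      using that by linarith
    ultimately show ?thesis
      using norm_ge_zero by blast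
  qed
  finally have err: "norm (w\<^sup>2 / 2 + (1 + w) * \<rho> / w) \<le> norm w * (3 / 10)"
    by simp
  have "norm (w / 2) = norm w / 2"
    by (simp add: norm_divide)
  then show "norm (cutoff' s) \<le> exp (Re s)"
    using norm_triangle_ineq4[of "w / 2" "w\<^sup>2 / 2 + (1 + w) * \<rho> / w"] err norm_ge_zero[of w]
    unfolding eq nw[symmetric] by linarith
  show "Re (cutoff' s) \<ge> exp (Re s) / 8" if "\<bar>Im s\<bar> \<le> 1 / 2"
    using Re_Im_exp_narrow(2)[OF that] err abs_Re_le_cmod[of "w\<^sup>2 / 2 + (1 + w) * \<rho> / w"]
    unfolding eq nw by (simp add: w_def[symmetric])
qed

lemma norm_cutoff_le:
  assumes "Re s \<le> 0"
  shows "norm (cutoff s) \<le> 3 * exp (Re s)"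
proof -
  define w where "w = exp s"
  have nw: "norm w = exp (Re s)" and w0: "w \<noteq> 0"
    by (auto simp: w_def)
  have w1: "norm w \<le> 1"
    using assms by (simp add: nw)
  have "norm (exp (- w) - (\<Sum>k\<le>1. (- w) ^ k / fact k)) \<le> exp \<bar>Re (- w)\<bar> * norm (- w) ^ 2"
    using Taylor_exp[of "- w" 1] by (simp add: eval_nat_numeral)
  also have "\<dots> \<le> 3 * norm (- w) ^ 2"
  proof (rule mult_right_mono)
    have "exp \<bar>Re (- w)\<bar> \<le> exp 1"
      using w1 abs_Re_le_cmod[of w] by simp
    then show "exp \<bar>Re (- w)\<bar> \<le> 3"
      using exp_le by linarith
  qed simp
  finally have "norm (exp (- w) - 1 + w) \<le> 3 * norm w ^ 2"
    by (simp add: algebra_simps)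
  then have "norm (exp (- w) - 1 + w) / norm w \<le> 3 * norm w ^ 2 / norm w"
    by (intro divide_right_mono) auto
  then show ?thesis
    using w0 unfolding cutoff_of_exp nw[symmetric] w_def[symmetric]
    by (simp add: norm_divide power2_eq_square)
qed

definition rcutoff :: "real \<Rightarrow> real" where
  "rcutoff s = 1 - (1 - exp (- exp s)) * exp (- s)"

definition rcutoff' :: "real \<Rightarrow> real" where
  "rcutoff' s = exp (- s) - exp (- exp s) * (1 + exp (- s))"

lemma cutoff_of_real: "cutoff (of_real s) = of_real (rcutoff s)"
  and cutoff'_of_real: "cutoff' (of_real s) = of_real (rcutoff' s)"
  by (simp_all add: cutoff_def cutoff'_def rcutoff_def rcutoff'_def flip: exp_of_real)

lemma rcutoff'_pos: "rcutoff' s > 0"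
  using Re_cutoff'_pos[of "of_real s"] by (simp add: cutoff'_of_real)

lemma rcutoff'_le_1: "rcutoff' s \<le> 1"
proof -
  have "1 - exp s \<le> exp (- exp s)"
    using exp_ge_add_one_self[of "- exp s"] by simp
  then have "(1 - exp s) * (1 + exp (- s)) \<le> exp (- exp s) * (1 + exp (- s))"
    by (intro mult_right_mono) (auto simp: add_nonneg_nonneg)
  moreover have "(1 - exp s) * (1 + exp (- s)) = exp (- s) - exp s"
    by (simp add: algebra_simps flip: exp_add)
  moreover have "exp (- exp s) * (1 + exp (- s)) \<ge> exp (- s) - 1"
  proof (cases "s \<ge> 0")
    case True
    then have "exp (- s) - 1 \<le> 0"
      by simp
    also have "0 \<le> exp (- exp s) * (1 + exp (- s))"
      by (intro mult_nonneg_nonneg add_nonneg_nonneg) auto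
    finally show ?thesis .
  next
    case False
    then show ?thesis using calculation by (smt (verit) exp_le_one_iff)
  qed
  ultimately show ?thesis
    by (simp add: rcutoff'_def)
qed

lemma rcutoff_le_1: "rcutoff s \<le> 1"
  by (simp add: rcutoff_def)

lemma rcutoff_ge: "1 - exp (- s) \<le> rcutoff s"
  by (simp add: rcutoff_def algebra_simps)

lemma rcutoff_nonneg: "0 \<le> rcutoff s"
proof -
  have "1 - exp (- exp s) \<le> exp s"
    using exp_ge_add_one_self[of "- exp s"] by simp
  then have "(1 - exp (- exp s)) * exp (- s) \<le> exp s * exp (- s)"
    by (intro mult_right_mono) auto
  then show ?thesis
    by (simp add: rcutoff_def flip: exp_add)
qed

lemma rcutoff_le_exp:
  assumes "s \<le> 0"
  shows "rcutoff s \<le> 3 * exp s"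
  using norm_cutoff_le[of "of_real s"] assms
  by (simp add: cutoff_of_real)

lemma rcutoff'_le_exp:
  assumes "s \<le> - 2"
  shows "rcutoff' s \<le> exp s"
  using norm_cutoff'_le[of "of_real s"] assms
  by (simp add: cutoff'_of_real)

section \<open>A step function with prescribed places\<close>

lemma summable_exp_neg: "summable (\<lambda>k. exp (- 1 :: real) ^ k)"
  by (rule summable_geometric) simp

lemma exp_neg_of_nat: "exp (- 1 :: real) ^ k = exp (- real k)"
  by (simp flip: exp_of_nat_mult)

lemma suminf_exp_neg_le: "(\<Sum>k. exp (- 1 :: real) ^ k) \<le> 2"
proof -
  have "exp (- 1) \<le> (1 / 2 :: real)"
    using exp_ge_add_one_self[of 1] by (simp add: exp_minus field_simps)
  then show ?thesis
    by (subst suminf_geometric) (auto simp: field_simps)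
qed

lemma four_pow_exp_le: "4 ^ k * exp (- (4 * real k)) \<le> (1 / 9) ^ k"
proof -
  have "5 / 2 \<le> exp (1 :: real)"
    using exp_lower_Taylor_quadratic[of 1] by simp
  then have "(5 / 2) ^ 4 \<le> (exp 1 :: real) ^ 4"
    by (rule power_mono) simp
  then have "(36 :: real) \<le> exp 4"
    using exp_of_nat_mult[of 4 "1::real"] by (simp add: power_divide)
  then have "4 * exp (- 4) \<le> (1 / 9 :: real)"
    by (simp add: exp_minus field_simps)
  then have "(4 * exp (- 4)) ^ k \<le> (1 / 9 :: real) ^ k"
    by (rule power_mono) simp
  then show ?thesis
    by (simp add: power_mult_distrib mult.commute flip: exp_of_nat_mult)
qed

lemma two_mult_le_two_pow: "2 * real k \<le> 2 ^ k"
proof (induction k)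
  case (Suc k)
  show ?case
  proof (cases k)
    case (Suc j)
    have "2 \<le> (2::real) ^ Suc j"
      using one_le_power[of "2::real" j] by simp
    then show ?thesis
      using Suc.IH Suc by simp
  qed simp
qed simp

lemma Re_four_pow_mult: "Re (4 ^ k * w) = 4 ^ k * Re w"
proof -
  have "(4 :: complex) ^ k = of_real (4 ^ k)"
    by simp
  then show ?thesis
    by (simp only: times_complex.sel Re_complex_of_real Im_complex_of_real)
qed

text \<open>
  The places \<open>l k\<close> are where the step function drops. The drop at \<open>l k\<close> has steepness \<open>4\<^sup>k\<close>, and
  the gap \<open>2\<^sup>-\<^sup>k\<close> is long compared with the length \<open>4\<^sup>-\<^sup>k\<close> on which it takes place. The gaps are
  summable, so demanding them costs only a bounded shift of the places.
\<close>
locale speed_steps =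
  fixes l :: "nat \<Rightarrow> real"
  assumes l_0: "0 \<le> l 0"
    and gap: "\<And>k. l k + (1 / 2) ^ k \<le> l (Suc k)"
    and l_top: "filterlim l at_top sequentially"
begin

lemma l_Suc: "l k < l (Suc k)"
  using gap[of k] by (smt (verit) zero_less_power half_gt_zero zero_less_one)

lemma l_mono: "j \<le> k \<Longrightarrow> l j \<le> l k"
  using lift_Suc_mono_le[of l] l_Suc less_imp_le by blast

lemma scaled_gap_left:
  assumes "j < m"
  shows "2 ^ j \<le> 4 ^ j * (l m - l j)"
proof -
  have "(1 / 2) ^ j \<le> l m - l j"
    using gap[of j] l_mono[of "Suc j" m] assms by simp
  then have "4 ^ j * (1 / 2) ^ j \<le> 4 ^ j * (l m - l j)"
    by (rule mult_left_mono) simp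
  then show ?thesis
    by (simp flip: power_mult_distrib)
qed

lemma scaled_gap_right:
  assumes "j < m"
  shows "2 * 2 ^ m \<le> 4 ^ m * (l m - l j)"
proof -
  obtain n where n: "m = Suc n"
    using assms by (cases m) auto
  have "(1 / 2) ^ n \<le> l m - l j"
    using gap[of n] l_mono[of j n] assms n by simp
  then have "4 ^ m * (1 / 2) ^ n \<le> 4 ^ m * (l m - l j)"
    by (rule mult_left_mono) simp
  moreover have "(4::real) ^ m * (1 / 2) ^ n = 2 * 2 ^ m"
    by (simp add: n flip: power_mult_distrib)
  ultimately show ?thesis
    by simp
qed

text \<open>
  The scaled variable in which the \<open>k\<close>-th drop is the standard cutoff.
\<close>
definition stage :: "nat \<Rightarrow> complex \<Rightarrow> complex" where
  "stage k z = of_real (4 ^ k) * (z - of_real (l k))"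

lemma Re_stage: "Re (stage k z) = 4 ^ k * (Re z - l k)"
  and Im_stage: "Im (stage k z) = 4 ^ k * Im z"
  by (simp_all add: stage_def flip: of_real_power)

lemma stage_of_real: "stage k (of_real x) = of_real (4 ^ k * (x - l k))"
  by (simp add: stage_def)

definition G :: "complex \<Rightarrow> complex" where "G z = (\<Sum>k. cutoff (stage k z))"
definition G' :: "complex \<Rightarrow> complex" where "G' z = (\<Sum>k. 4 ^ k * cutoff' (stage k z))"

lemma
  shows G_sums: "(\<lambda>k. cutoff (stage k z)) sums G z"
    and G'_sums: "(\<lambda>k. 4 ^ k * cutoff' (stage k z)) sums G' z"
    and G_deriv: "(G has_field_derivative G' z) (at z)"
proof -
  have "\<exists>g g'. \<forall>x\<in>UNIV. (\<lambda>k. cutoff (stage k x)) sums g x \<and>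
      (\<lambda>k. 4 ^ k * cutoff' (stage k x)) sums g' x \<and> (g has_field_derivative g' x) (at x)"
  proof (rule series_and_derivative_comparison_local)
    show "((\<lambda>z. cutoff (stage k z)) has_field_derivative 4 ^ k * cutoff' (stage k z)) (at z)" for k z
      unfolding stage_def
      by (rule DERIV_cong[OF DERIV_chain2[OF has_field_derivative_cutoff]])
        (auto intro!: derivative_eq_intros)
    show "\<exists>d h. 0 < d \<and> summable h \<and>
        (\<forall>\<^sub>F k in sequentially. \<forall>y\<in>ball x d \<inter> UNIV. norm (cutoff (stage k y)) \<le> h k)" for x
    proof (intro exI conjI)
      show "(0::real) < 1"
        by simp
      show "summable (\<lambda>k. 3 * exp (- 1 :: real) ^ k)"
        by (intro summable_mult summable_exp_neg)
      have "\<forall>\<^sub>F k in sequentially. Re x + 2 \<le> l k"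
        using l_top by (simp add: filterlim_at_top)
      then show "\<forall>\<^sub>F k in sequentially. \<forall>y\<in>ball x 1 \<inter> UNIV. norm (cutoff (stage k y)) \<le> 3 * exp (- 1) ^ k"
      proof eventually_elim
        case (elim k)
        show ?case
        proof
          fix y
          assume "y \<in> ball x 1 \<inter> UNIV"
          then have "Re y - l k \<le> - 1"
            using elim abs_Re_le_cmod[of "x - y"] by (simp add: dist_norm)
          then have "4 ^ k * (Re y - l k) \<le> 4 ^ k * (- 1)"
            by (rule mult_left_mono) simp
          moreover have "real k \<le> 4 ^ k"
            using of_nat_less_two_power[of k, where ?'a = real] power_mono[of 2 "4::real" k] by linarith
          ultimately have "Re (stage k y) \<le> - real k"
            unfolding Re_stage by linarith
          then have "norm (cutoff (stage k y)) \<le> 3 * exp (- real k)"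
            using norm_cutoff_le[of "stage k y"] by (smt (verit) exp_le_cancel_iff of_nat_0_le_iff)
          then show "norm (cutoff (stage k y)) \<le> 3 * exp (- 1) ^ k"
            by (simp flip: exp_of_nat_mult)
        qed
      qed
    qed
  qed simp
  then obtain g g' where g: "\<And>x. (\<lambda>k. cutoff (stage k x)) sums g x"
    "\<And>x. (\<lambda>k. 4 ^ k * cutoff' (stage k x)) sums g' x"
    "\<And>x. (g has_field_derivative g' x) (at x)"
    by blast
  have "G = g" "G' = g'"
    using g by (auto simp: G_def G'_def sums_iff)
  with g show "(\<lambda>k. cutoff (stage k z)) sums G z" "(\<lambda>k. 4 ^ k * cutoff' (stage k z)) sums G' z"
    "(G has_field_derivative G' z) (at z)"
    by simp_all
qed

definition g :: "real \<Rightarrow> real" where "g x = Re (G (of_real x))"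
definition g' :: "real \<Rightarrow> real" where "g' x = Re (G' (of_real x))"

lemma g_sums: "(\<lambda>k. rcutoff (4 ^ k * (x - l k))) sums g x"
  using sums_Re[OF G_sums[of "of_real x"]]
  by (simp only: g_def stage_of_real cutoff_of_real Re_complex_of_real)

lemma stage_deriv_of_real:
  "4 ^ k * cutoff' (stage k (of_real x)) = of_real (4 ^ k * rcutoff' (4 ^ k * (x - l k)))"
  by (simp only: stage_of_real cutoff'_of_real) simp

lemma g'_sums: "(\<lambda>k. 4 ^ k * rcutoff' (4 ^ k * (x - l k))) sums g' x"
  using sums_Re[OF G'_sums[of "of_real x"]]
  by (simp only: g'_def stage_deriv_of_real Re_complex_of_real)

lemma G_of_real: "G (of_real x) = of_real (g x)"
  using sums_of_real[OF g_sums[of x], where ?'a = complex] G_sums[of "of_real x"]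
  by (simp only: stage_of_real cutoff_of_real sums_iff)

lemma G'_of_real: "G' (of_real x) = of_real (g' x)"
  using sums_of_real[OF g'_sums[of x], where ?'a = complex] G'_sums[of "of_real x"]
  by (simp only: stage_deriv_of_real sums_iff)

text \<open>
  To the right of \<open>l i\<close> the first \<open>i\<close> cutoffs differ from \<open>1\<close> by a summable error.
\<close>
lemma g_ge:
  assumes "l i \<le> x"
  shows "real i - 2 \<le> g x"
proof -
  have le: "(if k \<in> {..<i} then 1 else 0) - exp (- 1) ^ k \<le> rcutoff (4 ^ k * (x - l k))" for k
  proof (cases "k < i")
    case True
    have "4 ^ k * (l i - l k) \<le> 4 ^ k * (x - l k)"
      using assms by (intro mult_left_mono) auto
    then have "real k \<le> 4 ^ k * (x - l k)"
      using scaled_gap_left[OF True] of_nat_less_two_power[of k, where ?'a = real] by linarith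
    then have "exp (- (4 ^ k * (x - l k))) \<le> exp (- real k)"
      by simp
    then show ?thesis
      using rcutoff_ge[of "4 ^ k * (x - l k)"] True
      by (simp only: exp_neg_of_nat lessThan_iff if_True)
  next
    case False
    then show ?thesis
      using rcutoff_nonneg[of "4 ^ k * (x - l k)"] by (smt (verit) exp_gt_zero lessThan_iff zero_less_power)
  qed
  have "(\<lambda>k. (if k \<in> {..<i} then 1 else 0) - exp (- 1) ^ k) sums
      ((\<Sum>k<i. 1) - (\<Sum>k. exp (- 1 :: real) ^ k))"
    by (intro sums_diff sums_If_finite_set summable_sums summable_exp_neg) simp
  from sums_le[OF le this g_sums] show ?thesis
    using suminf_exp_neg_le by simp
qed

lemma g_nonneg: "0 \<le> g x"
  using sums_le[OF _ sums_zero g_sums[of x]] rcutoff_nonneg by simp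

text \<open>
  To the left of \<open>l i\<close> the cutoffs beyond the \<open>i\<close>-th one have a bounded sum.
\<close>
lemma g_le:
  assumes "x \<le> l i"
  shows "g x \<le> real i + 7"
proof -
  have le: "rcutoff (4 ^ k * (x - l k)) \<le> (if k \<in> {..i} then 1 else 0) + 3 * exp (- 1) ^ k" for k
  proof (cases "k \<le> i")
    case True
    then show ?thesis
      using rcutoff_le_1[of "4 ^ k * (x - l k)"] by (simp add: add_increasing2)
  next
    case False
    then have "i < k"
      by simp
    have "4 ^ k * (x - l k) \<le> 4 ^ k * (l i - l k)"
      using assms by (intro mult_left_mono) auto
    moreover have "4 ^ k * (l i - l k) = - (4 ^ k * (l k - l i))"
      by (simp add: algebra_simps)
    ultimately have s: "4 ^ k * (x - l k) \<le> - real k"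
      using scaled_gap_right[OF \<open>i < k\<close>] of_nat_less_two_power[of k, where ?'a = real]
      by linarith
    then have "rcutoff (4 ^ k * (x - l k)) \<le> 3 * exp (4 ^ k * (x - l k))"
      by (intro rcutoff_le_exp) simp
    also have "\<dots> \<le> 3 * exp (- real k)"
      using s by simp
    finally show ?thesis
      using False by (simp flip: exp_of_nat_mult)
  qed
  have "(\<lambda>k. (if k \<in> {..i} then 1 else 0) + 3 * exp (- 1) ^ k) sums
      ((\<Sum>k\<le>i. 1) + 3 * (\<Sum>k. exp (- 1 :: real) ^ k))"
    by (intro sums_add sums_mult sums_If_finite_set summable_sums summable_exp_neg) simp
  from sums_le[OF le g_sums this] show ?thesis
    using suminf_exp_neg_le by simp
qed

text \<open>
  To the left of \<open>l J\<close>, a later and steeper cutoff is smaller than the one at \<open>l J\<close> by a factor that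
  makes the sum over all later cutoffs negligible.
\<close>
lemma far_stage_le:
  assumes "Re z \<le> l J" "J < k"
  shows "Re (stage k z) \<le> Re (stage J z) - 4 * real k"
proof -
  have "4 ^ k * (Re z - l J) \<le> 4 ^ J * (Re z - l J)"
    using assms by (intro mult_right_mono_neg power_increasing) auto
  then show ?thesis
    using scaled_gap_right[OF assms(2)] two_mult_le_two_pow[of k] unfolding Re_stage
    by (simp add: algebra_simps)
qed

text \<open>
  The width of the strip suits the cutoffs up to index \<open>J\<close>, which contribute a positive real part. The
  steeper ones oscillate in this strip, but to the left of \<open>l J\<close> all of them together are dominated
  by the \<open>J\<close>-th term. Comparison with that term, instead of an absolute bound, is what allows
  the places \<open>l k\<close> to be arbitrarily far apart.
\<close>
lemma Re_G'_nonneg: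
  assumes "Re z \<le> l J - 2 / 4 ^ J" "\<bar>Im z\<bar> \<le> 1 / (2 * 4 ^ J)"
  shows "0 \<le> Re (G' z)"
proof -
  define E where "E = exp (Re (stage J z))"
  have zJ: "Re z \<le> l J"
    using assms(1) by (smt (verit) divide_nonneg_pos zero_less_power)
  have J2: "Re (stage J z) \<le> - 2"
  proof -
    have "4 ^ J * (Re z - l J) \<le> 4 ^ J * (- (2 / 4 ^ J))"
      using assms(1) by (intro mult_left_mono) auto
    then show ?thesis
      by (simp add: Re_stage)
  qed
  have im: "\<bar>Im (stage k z)\<bar> \<le> 1 / 2" if "k \<le> J" for k
  proof -
    have "\<bar>Im (stage k z)\<bar> \<le> 4 ^ J * (1 / (2 * 4 ^ J))"
      unfolding Im_stage abs_mult using assms(2) that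
      by (intro mult_mono) (auto intro: power_increasing)
    then show ?thesis
      by simp
  qed
  \<comment> \<open>The constant \<open>1/8\<close> in the lower bound for the \<open>J\<close>-th term equals the sum of \<open>9\<^sup>-\<^sup>k\<close> over \<open>k \<ge> 1\<close>,
    which bounds the later terms; the correction at \<open>k = 0\<close> starts that sum at \<open>1\<close>.\<close>
  define lower where
    "lower k = (if k = J then E / 8 else 0) - (E * (1 / 9) ^ k - (if k = 0 then E else 0))" for k
  have le: "lower k \<le> 4 ^ k * Re (cutoff' (stage k z))" for k
  proof -
    have nonneg: "0 \<le> E * (1 / 9) ^ k - (if k = 0 then E else 0)"
      by (auto simp: E_def)
    consider "k < J" | "k = J" | "J < k"
      by linarith
    then show ?thesis
    proof cases
      case 1
      then have "0 < Re (cutoff' (stage k z))"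
        by (intro Re_cutoff'_pos im) simp
      then have "0 \<le> 4 ^ k * Re (cutoff' (stage k z))"
        by simp
      then show ?thesis
        using nonneg 1 unfolding lower_def by simp
    next
      case 2
      have "E / 8 \<le> Re (cutoff' (stage J z))"
        unfolding E_def by (intro Re_cutoff'_ge J2 im) simp
      moreover have "1 * Re (cutoff' (stage J z)) \<le> 4 ^ J * Re (cutoff' (stage J z))"
        using Re_cutoff'_pos[OF im[of J]] by (intro mult_right_mono) auto
      ultimately show ?thesis
        using nonneg 2 unfolding lower_def by simp
    next
      case 3
      then have s: "Re (stage k z) \<le> Re (stage J z) - 4 * real k"
        by (intro far_stage_le zJ)
      have "norm (cutoff' (stage k z)) \<le> exp (Re (stage k z))"
        using s J2 by (intro norm_cutoff'_le) simp
      also have "\<dots> \<le> exp (Re (stage J z) - 4 * real k)"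
        using s by simp
      also have "\<dots> = E * exp (- (4 * real k))"
        by (simp add: E_def flip: exp_add)
      finally have "4 ^ k * norm (cutoff' (stage k z)) \<le> 4 ^ k * (E * exp (- (4 * real k)))"
        by (intro mult_left_mono) auto
      also have "\<dots> = E * (4 ^ k * exp (- (4 * real k)))"
        by simp
      also have "\<dots> \<le> E * (1 / 9) ^ k"
        by (intro mult_left_mono four_pow_exp_le) (simp add: E_def)
      finally have "4 ^ k * norm (cutoff' (stage k z)) \<le> E * (1 / 9) ^ k" .
      moreover have "4 ^ k * (- norm (cutoff' (stage k z))) \<le> 4 ^ k * Re (cutoff' (stage k z))"
        using abs_Re_le_cmod[of "cutoff' (stage k z)"] by (intro mult_left_mono) auto
      ultimately show ?thesis
        using 3 unfolding lower_def by simp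
    qed
  qed
  have "lower sums (E / 8 - (E * (1 / (1 - 1 / 9)) - E))"
    unfolding lower_def
    by (intro sums_diff sums_mult geometric_sums sums_single[where f = "\<lambda>_. E / 8"]
        sums_single[where f = "\<lambda>_. E"]) simp
  moreover have "(\<lambda>k. 4 ^ k * Re (cutoff' (stage k z))) sums Re (G' z)"
    using sums_Re[OF G'_sums[of z]] by (simp only: Re_four_pow_mult)
  ultimately have "E / 8 - (E * (1 / (1 - 1 / 9)) - E) \<le> Re (G' z)"
    by (rule sums_le[OF le])
  then show ?thesis
    by simp
qed

lemma g'_le:
  assumes "x < l j"
  shows "g' x \<le> 4 ^ Suc j / 3 + 9 / 8"
proof -
  have le: "4 ^ k * rcutoff' (4 ^ k * (x - l k)) \<le> (if k \<in> {..j} then 4 ^ k else 0) + (1 / 9) ^ k" for k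
  proof (cases "k \<le> j")
    case True
    then show ?thesis
      using rcutoff'_le_1[of "4 ^ k * (x - l k)"] by (simp add: add_increasing2)
  next
    case False
    have "Re (stage k (of_real x)) \<le> Re (stage j (of_real x)) - 4 * real k"
      using False assms by (intro far_stage_le) auto
    moreover have "Re (stage j (of_real x)) \<le> 0"
      using assms by (simp add: Re_stage mult_nonneg_nonpos)
    ultimately have s: "4 ^ k * (x - l k) \<le> - (4 * real k)"
      by (simp add: Re_stage)
    have "rcutoff' (4 ^ k * (x - l k)) \<le> exp (4 ^ k * (x - l k))"
      using s False by (intro rcutoff'_le_exp) simp
    also have "\<dots> \<le> exp (- (4 * real k))"
      using s by simp
    finally have "4 ^ k * rcutoff' (4 ^ k * (x - l k)) \<le> 4 ^ k * exp (- (4 * real k))"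
      by (intro mult_left_mono) auto
    then show ?thesis
      using four_pow_exp_le[of k] False by (simp only: atMost_iff if_False; linarith)
  qed
  have "(\<lambda>k. (if k \<in> {..j} then 4 ^ k else 0) + (1 / 9) ^ k) sums
      ((\<Sum>k\<le>j. 4 ^ k) + 1 / (1 - 1 / 9 :: real))"
    by (intro sums_add sums_If_finite_set geometric_sums) auto
  from sums_le[OF le g'_sums this]
  have "g' x \<le> (\<Sum>k\<le>j. 4 ^ k) + 9 / 8"
    by simp
  also have "(\<Sum>k\<le>j. 4 ^ k :: real) \<le> 4 ^ Suc j / 3"
    by (induction j) auto
  finally show ?thesis
    by simp
qed

end

section \<open>The invariant channel\<close>

lemma Re_one_plus_exp_pos:
  assumes "\<bar>Im z\<bar> < pi / 2"
  shows "0 < Re (1 + exp z)"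
proof -
  have "0 < cos (Im z)"
    using assms by (intro cos_gt_zero_pi) auto
  then show ?thesis
    by (simp add: Re_exp add_pos_pos)
qed

lemma one_plus_exp_nonzero:
  assumes "\<bar>Im z\<bar> < pi / 2"
  shows "1 + exp z \<noteq> 0"
  using Re_one_plus_exp_pos[OF assms] by (metis less_irrefl zero_complex.sel(1))

lemma exp_minus_odd_pi_i: "exp (- odd_pi_i k) = - 1"
proof -
  have "exp (odd_pi_i k) = cis (real (2 * k + 1) * pi)"
    by (simp add: odd_pi_i_def cis_conv_exp algebra_simps)
  also have "\<dots> = cis pi ^ (2 * k + 1)"
    by (rule Complex.DeMoivre[symmetric])
  also have "\<dots> = - 1"
    by simp
  finally show ?thesis
    by (simp add: exp_minus)
qed

context speed_steps
begin

text \<open>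
  The factor \<open>1 + e\<^sup>-\<^sup>z\<close> lies between \<open>1\<close> and \<open>2\<close> on the positive axis and provides the zeros, which become
  fixed points of the map.
\<close>
definition speed :: "complex \<Rightarrow> complex" where "speed z = (1 + exp (- z)) * exp (- (4 * G z))"
definition rspeed :: "real \<Rightarrow> real" where "rspeed x = (1 + exp (- x)) * exp (- (4 * g x))"

text \<open>
  The function \<open>decay\<close> is the negative logarithmic derivative of the speed.
\<close>
definition log_speed :: "complex \<Rightarrow> complex" where "log_speed z = Ln (1 + exp (- z)) - 4 * G z"
definition decay :: "complex \<Rightarrow> complex" where "decay z = 1 / (1 + exp z) + 4 * G' z"
definition rdecay :: "real \<Rightarrow> real" where "rdecay x = 1 / (1 + exp x) + 4 * g' x"

lemma speed_of_real: "speed (of_real x) = of_real (rspeed x)"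
  unfolding speed_def rspeed_def G_of_real by (simp flip: exp_of_real)

lemma decay_of_real: "decay (of_real x) = of_real (rdecay x)"
  unfolding decay_def rdecay_def G'_of_real by (simp flip: exp_of_real)

lemma rspeed_pos: "0 < rspeed x"
  unfolding rspeed_def by (intro mult_pos_pos add_pos_pos) auto

lemma holomorphic_G: "G holomorphic_on A"
  using G_deriv by (meson holomorphic_on_def field_differentiable_at_within field_differentiable_def)

lemma holomorphic_G': "G' holomorphic_on A"
proof -
  have "deriv G = G'"
    using G_deriv by (auto intro: DERIV_imp_deriv)
  moreover have "deriv G holomorphic_on UNIV"
    by (intro holomorphic_deriv holomorphic_G) simp
  ultimately show ?thesis
    using holomorphic_on_subset by auto
qed

lemma holomorphic_speed: "speed holomorphic_on A"
  unfolding speed_def[abs_def] by (intro holomorphic_intros holomorphic_G)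

lemma exp_log_speed:
  assumes "\<bar>Im z\<bar> < pi / 2"
  shows "speed z = exp (log_speed z)"
proof -
  have "1 + exp (- z) \<noteq> 0"
    using one_plus_exp_nonzero[of "- z"] assms by simp
  then show ?thesis
    unfolding speed_def log_speed_def exp_diff by (simp add: exp_minus field_simps)
qed

lemma log_speed_deriv:
  assumes "\<bar>Im z\<bar> < pi / 2"
  shows "(log_speed has_field_derivative - decay z) (at z)"
proof -
  have "0 < Re (1 + exp (- z))"
    using Re_one_plus_exp_pos[of "- z"] assms by simp
  then have notin: "1 + exp (- z) \<notin> \<real>\<^sub>\<le>\<^sub>0"
    by (auto simp: complex_nonpos_Reals_iff)
  have nz: "1 + exp (- z) \<noteq> 0" and nz': "1 + exp z \<noteq> 0"
    using one_plus_exp_nonzero[of z] one_plus_exp_nonzero[of "- z"] assms by simp_all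
  have "((\<lambda>z. Ln (1 + exp (- z)) - 4 * G z) has_field_derivative
      (- exp (- z)) / (1 + exp (- z)) - 4 * G' z) (at z)"
    by (rule derivative_eq_intros G_deriv notin refl | simp add: notin)+
      (simp add: divide_inverse mult.commute)
  moreover have "(- exp (- z)) / (1 + exp (- z)) = - (1 / (1 + exp z))"
    using nz nz' by (simp add: exp_minus divide_simps add_ac) 
  ultimately show ?thesis
    unfolding log_speed_def[abs_def] decay_def by simp
qed

lemma rspeed_le:
  assumes "0 \<le> x" "l i \<le> x"
  shows "rspeed x \<le> 2 * exp (8 - 4 * real i)"
proof -
  have "1 + exp (- x) \<le> 2"
    using assms by simp
  moreover have "exp (- (4 * g x)) \<le> exp (8 - 4 * real i)"
    using g_ge[OF assms(2)] by simp
  ultimately show ?thesis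
    unfolding rspeed_def by (intro mult_mono) auto
qed

lemma rspeed_le_2:
  assumes "0 \<le> x"
  shows "rspeed x \<le> 2"
proof -
  have "1 + exp (- x) \<le> 2" "exp (- (4 * g x)) \<le> 1"
    using assms g_nonneg[of x] by simp_all
  then have "rspeed x \<le> 2 * 1"
    unfolding rspeed_def by (intro mult_mono) auto
  then show ?thesis
    by simp
qed

lemma rspeed_ge:
  assumes "x \<le> l i"
  shows "exp (- 28 - 4 * real i) \<le> rspeed x"
proof -
  have "1 * exp (- 28 - 4 * real i) \<le> (1 + exp (- x)) * exp (- (4 * g x))"
    using g_le[OF assms] by (intro mult_mono) auto
  then show ?thesis
    by (simp add: rspeed_def)
qed

text \<open>
  The constant is chosen such that the width is at most \<open>1/41\<close> of the radius of the discs on which \<open>decay\<close>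
  has positive real part.
\<close>
definition aperture :: real where "aperture = 1 / (41 * 16 * exp 6)"

text \<open>
  Iteration contracts the distance from the real axis in proportion to the speed. The square root
  makes the channel narrow more slowly than that, which leaves room for errors, and still fast
  enough to stay within the strips on which the next cutoff is controlled.
\<close>
definition width :: "real \<Rightarrow> real" where "width x = aperture * sqrt (rspeed x)"

lemma width_pos: "0 < width x"
  unfolding width_def aperture_def using rspeed_pos by simp

lemma rdecay_pos: "0 < rdecay x"
proof -
  have "0 \<le> g' x"
    using sums_le[OF _ sums_zero g'_sums[of x]] rcutoff'_pos by (simp add: less_imp_le)
  then show ?thesis
    unfolding rdecay_def by (simp add: add_pos_nonneg add_pos_pos)
qed

text \<open>
  About a point between \<open>l (j - 1)\<close> and \<open>l j\<close>, the disc of radius \<open>4\<^sup>-\<^sup>j/8\<close> stays to the left of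
  \<open>l (j + 1)\<close>, with a margin, and inside the strip for the cutoff of index \<open>j + 1\<close>. The speed at this
  point is at most of order \<open>e\<^sup>-\<^sup>4\<^sup>j\<close>, and its square root is at most a constant multiple of the radius
  since \<open>e\<^sup>-\<^sup>2 < 1/4\<close>.
\<close>
lemma regular_ball:
  assumes "0 \<le> x"
  obtains R where "0 < R" "width x \<le> R / 41" "width x * rdecay x \<le> 1 / 10"
    "\<And>z. z \<in> ball (of_real x) R \<Longrightarrow> 0 < Re (decay z) \<and> \<bar>Im z\<bar> < pi / 2"
proof
  have "\<exists>j. x < l j"
    using l_top by (auto simp: filterlim_at_top_dense eventually_sequentially)
  define j where "j = (LEAST j. x < l j)"
  have xj: "x < l j"
    unfolding j_def using \<open>\<exists>j. x < l j\<close> by (rule LeastI_ex)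
  define R :: real where "R = 1 / (2 * 4 ^ Suc j)"
  show R: "0 < R"
    by (simp add: R_def)
  have "rspeed x \<le> 2 * exp (12 - 4 * real j)"
  proof (cases j)
    case 0
    then show ?thesis
      using rspeed_le_2[OF assms] by (smt (verit) exp_ge_add_one_self of_nat_0)
  next
    case (Suc i)
    then have "\<not> x < l i"
      unfolding j_def by (intro not_less_Least) simp
    then show ?thesis
      using rspeed_le[OF assms, of i] Suc by (simp add: algebra_simps)
  qed
  also have "\<dots> \<le> (2 * exp (6 - 2 * real j))\<^sup>2"
    by (simp add: power_mult_distrib flip: exp_double)
  finally have "sqrt (rspeed x) \<le> sqrt ((2 * exp (6 - 2 * real j))\<^sup>2)"
    by (rule real_sqrt_le_mono)
  also have "\<dots> = 2 * exp (6 - 2 * real j)"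
    by (rule real_sqrt_unique) auto
  also have "\<dots> = 2 * exp 6 * exp (- 2) ^ j"
    by (simp add: exp_diff exp_minus power_one_over divide_simps flip: exp_of_nat_mult)
  also have "\<dots> \<le> 2 * exp 6 * (1 / 4) ^ j"
  proof (intro mult_left_mono power_mono)
    have "4 \<le> exp (2 :: real)"
      using exp_lower_Taylor_quadratic[of 2] by simp
    then show "exp (- 2) \<le> (1 / 4 :: real)"
      by (simp add: exp_minus field_simps)
  qed auto
  also have "\<dots> = 16 * exp 6 * R"
    by (simp add: R_def power_one_over)
  finally have "width x \<le> aperture * (16 * exp 6 * R)"
    unfolding width_def by (intro mult_left_mono) (auto simp: aperture_def)
  then show wR: "width x \<le> R / 41"
    by (simp add: aperture_def)
  have four: "(4::real) ^ Suc j \<ge> 4"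
    using one_le_power[of "4::real" j] by simp
  have "rdecay x \<le> 1 / 2 + 4 * (4 ^ Suc j / 3 + 9 / 8)"
    unfolding rdecay_def using assms g'_le[OF xj]
    by (intro add_mono mult_left_mono) (auto simp: divide_simps add_pos_pos)
  also have "\<dots> \<le> 3 * 4 ^ Suc j"
  proof -
    have "1 / 2 + 4 * (X / 3 + 9 / 8) \<le> 3 * X" if "4 \<le> X" for X :: real
      using that by simp
    then show ?thesis
      using four by blast
  qed
  finally have "rdecay x \<le> 3 * 4 ^ Suc j" .
  then have "width x * rdecay x \<le> R / 41 * (3 * 4 ^ Suc j)"
    using rdecay_pos[of x] wR R by (intro mult_mono) auto
  also have "\<dots> \<le> 1 / 10"
    by (simp add: R_def)
  finally show "width x * rdecay x \<le> 1 / 10" .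
  show "0 < Re (decay z) \<and> \<bar>Im z\<bar> < pi / 2" if z: "z \<in> ball (of_real x) R" for z
  proof
    have re: "\<bar>Re z - x\<bar> < R" and im: "\<bar>Im z\<bar> < R"
      using z abs_Re_le_cmod[of "of_real x - z"] abs_Im_le_cmod[of "of_real x - z"]
      by (auto simp: dist_norm)
    have "R \<le> 1 / (2 * 1)"
      unfolding R_def by (intro divide_left_mono mult_left_mono one_le_power) auto
    then show strip: "\<bar>Im z\<bar> < pi / 2"
      using im pi_ge_two by linarith
    have "0 < Re (1 + exp z)"
      using Re_one_plus_exp_pos[OF strip] .
    then have pos: "0 < Re (1 / (1 + exp z))"
      by (simp add: Re_divide sum_power2_gt_zero_iff)
    have "0 \<le> Re (G' z)"
    proof (rule Re_G'_nonneg)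
      have "R + 2 / 4 ^ Suc j = 5 / 8 * (1 / 4) ^ j"
        by (simp add: R_def power_one_over)
      also have "\<dots> \<le> 1 * (1 / 4) ^ j"
        by (intro mult_right_mono) auto
      also have "\<dots> = (1 / 4) ^ j"
        by simp
      also have "\<dots> \<le> (1 / 2) ^ j"
        by (intro power_mono) auto
      finally have "R + 2 / 4 ^ Suc j \<le> (1 / 2) ^ j" .
      then show "Re z \<le> l (Suc j) - 2 / 4 ^ Suc j"
        using re xj gap[of j] R by linarith
      show "\<bar>Im z\<bar> \<le> 1 / (2 * 4 ^ Suc j)"
        using im by (simp add: R_def)
    qed
    with pos show "0 < Re (decay z)"
      by (simp add: decay_def)
  qed
qed

lemma width_rdecay_le:
  assumes "0 \<le> x"
  shows "width x * rdecay x \<le> 1 / 10"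
  by (rule regular_ball[OF assms])

text \<open>
  With \<open>t = 1/41\<close> the distortion factor \<open>2t / (1 - t)\<close> is \<open>1/20\<close>.
\<close>
lemma regular_distortion:
  assumes "0 \<le> x" "norm \<zeta> \<le> width x"
  shows "\<bar>Im \<zeta>\<bar> < pi / 2"
    and "norm (decay (of_real x + \<zeta>) - of_real (rdecay x)) \<le> rdecay x / 20"
proof -
  obtain R where R: "0 < R" "width x \<le> R / 41"
    and pos: "\<And>z. z \<in> ball (of_real x) R \<Longrightarrow> 0 < Re (decay z) \<and> \<bar>Im z\<bar> < pi / 2"
    using regular_ball[OF assms(1)] by metis
  have "of_real x + \<zeta> \<in> ball (of_real x) R"
    using assms(2) R by (simp add: dist_norm)
  then show "\<bar>Im \<zeta>\<bar> < pi / 2"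
    using pos by fastforce
  have nz: "1 + exp z \<noteq> 0" if "z \<in> ball (of_real x) R" for z :: complex
    using one_plus_exp_nonzero pos[OF that] by blast
  have "norm (decay (of_real x + \<zeta>) - decay (of_real x)) \<le> 2 * (1 / 41) / (1 - 1 / 41) * Re (decay (of_real x))"
  proof (rule Re_pos_distortion[where F = decay and t = "1 / 41", OF _ R(1)])
    show "decay holomorphic_on ball (of_real x) R"
      unfolding decay_def[abs_def] by (intro holomorphic_intros holomorphic_G' nz)
    show "0 < Re (decay z)" if "z \<in> ball (of_real x) R" for z
      using pos[OF that] ..
    show "dist (of_real x) (of_real x + \<zeta>) \<le> 1 / 41 * R"
      using assms(2) R(2) by (simp add: dist_norm)
  qed simp
  then show "norm (decay (of_real x + \<zeta>) - of_real (rdecay x)) \<le> rdecay x / 20"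
    by (simp add: decay_of_real)
qed

lemma log_speed_linear:
  assumes "0 \<le> x" "norm \<zeta> \<le> width x"
  shows "norm (log_speed (of_real x + \<zeta>) - log_speed (of_real x) + of_real (rdecay x) * \<zeta>)
      \<le> rdecay x / 20 * norm \<zeta>"
proof -
  define F where "F z = log_speed z + of_real (rdecay x) * z" for z :: complex
  have "norm (F (of_real x + \<zeta>) - F (of_real x)) \<le> rdecay x / 20 * norm (of_real x + \<zeta> - of_real x)"
  proof (rule field_differentiable_bound[where S = "cball (of_real x) (width x)"])
    fix z
    assume "z \<in> cball (complex_of_real x) (width x)"
    then have n: "norm (z - of_real x) \<le> width x"
      by (simp add: dist_norm norm_minus_commute)
    have "\<bar>Im z\<bar> < pi / 2"
      using regular_distortion(1)[OF assms(1) n] by simp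
    from log_speed_deriv[OF this]
    show "(F has_field_derivative (- decay z + of_real (rdecay x))) (at z within cball (of_real x) (width x))"
      unfolding F_def[abs_def]
      by (auto intro!: derivative_eq_intros elim: has_field_derivative_at_within)
    show "norm (- decay z + of_real (rdecay x)) \<le> rdecay x / 20"
      using regular_distortion(2)[OF assms(1) n] by (simp add: norm_minus_commute)
  qed (use assms(2) width_pos[of x] in \<open>auto simp: dist_norm\<close>)
  then show ?thesis
    by (simp add: F_def algebra_simps)
qed

lemma norm_speed_of_real: "norm (speed (of_real x)) = rspeed x"
  using rspeed_pos[of x] by (simp add: speed_of_real)

lemma rspeed_shift_ge:
  assumes "0 \<le> x" "0 \<le> u" "u \<le> width x"
  shows "rspeed x * exp (- (21 / 20 * (rdecay x * u))) \<le> rspeed (x + u)"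
proof -
  have n: "norm (complex_of_real u) \<le> width x"
    using assms by simp
  have "norm (log_speed (of_real x + of_real u) - log_speed (of_real x) + of_real (rdecay x) * of_real u)
      \<le> rdecay x / 20 * u"
    using log_speed_linear[OF assms(1) n] assms(2) by simp
  then have "\<bar>Re (log_speed (of_real (x + u)) - log_speed (of_real x) + of_real (rdecay x) * of_real u)\<bar>
      \<le> rdecay x / 20 * u"
    using abs_Re_le_cmod order_trans unfolding of_real_add by blast
  moreover have "Re (log_speed (of_real (x + u)) - log_speed (of_real x) + of_real (rdecay x) * of_real u)
      = Re (log_speed (of_real (x + u))) - Re (log_speed (of_real x)) + rdecay x * u"
    by (simp del: of_real_add)
  moreover have "rdecay x / 20 * u = 1 / 20 * (rdecay x * u)"
    by simp
  ultimately have "Re (log_speed (of_real x)) - 21 / 20 * (rdecay x * u) \<le> Re (log_speed (of_real (x + u)))"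
    by linarith
  then have "exp (Re (log_speed (of_real x))) * exp (- (21 / 20 * (rdecay x * u)))
      \<le> exp (Re (log_speed (of_real (x + u))))"
    by (simp flip: exp_add)
  moreover have "exp (Re (log_speed (of_real y))) = rspeed y" for y
    using exp_log_speed[of "of_real y"] norm_speed_of_real[of y] by simp
  ultimately show ?thesis
    by (simp del: of_real_add)
qed

text \<open>
  Near the real axis the speed is nearly exponential with rate \<open>rdecay x\<close>, and the exponential is
  expanded to first order.
\<close>
lemma speed_vertical:
  assumes "0 \<le> x" "\<bar>y\<bar> \<le> width x"
  obtains e where "speed (Complex x y) = of_real (rspeed x) * (1 - \<i> * of_real (y * rdecay x) + e)"
    "norm e \<le> \<bar>y\<bar> * rdecay x / 5"
proof
  define \<zeta> where "\<zeta> = \<i> * complex_of_real y"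
  have n: "norm \<zeta> = \<bar>y\<bar>"
    by (simp add: \<zeta>_def norm_mult)
  have xy: "Complex x y = of_real x + \<zeta>"
    by (simp add: \<zeta>_def complex_eq_iff)
  define \<omega> where "\<omega> = log_speed (of_real x + \<zeta>) - log_speed (of_real x)"
  define q where "q = \<bar>y\<bar> * rdecay x"
  have q0: "0 \<le> q"
    using rdecay_pos[of x] by (simp add: q_def)
  have q: "q \<le> 1 / 10"
  proof -
    have "width x * rdecay x \<le> 1 / 10"
      by (rule width_rdecay_le[OF assms(1)])
    moreover have "q \<le> width x * rdecay x"
      unfolding q_def using assms(2) rdecay_pos[of x] by (intro mult_right_mono) auto
    ultimately show ?thesis
      by simp
  qed
  have e1: "norm (\<omega> + of_real (rdecay x) * \<zeta>) \<le> q / 20"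
    using log_speed_linear[OF assms(1), of \<zeta>] n assms(2) by (simp add: \<omega>_def q_def mult.commute)
  have n\<omega>: "norm \<omega> \<le> 21 / 20 * q"
  proof -
    have "norm \<omega> \<le> norm (\<omega> + of_real (rdecay x) * \<zeta>) + norm (of_real (rdecay x) * \<zeta>)"
      using norm_triangle_ineq4[of "\<omega> + of_real (rdecay x) * \<zeta>" "of_real (rdecay x) * \<zeta>"] by simp
    moreover have "norm (of_real (rdecay x) * \<zeta>) = q"
      using rdecay_pos[of x] by (simp add: norm_mult n q_def)
    ultimately show ?thesis
      using e1 by simp
  qed
  \<comment> \<open>One factor of \<open>|\<omega>|\<^sup>2\<close> is bounded by a multiple of \<open>q\<close>, the other one by the constant \<open>21/200\<close>.\<close>
  have "norm (exp \<omega> - 1 - \<omega>) \<le> exp \<bar>Re \<omega>\<bar> * (norm \<omega>)\<^sup>2"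
    using Taylor_exp[of \<omega> 1] by (simp add: eval_nat_numeral algebra_simps)
  also have "\<dots> \<le> 6 / 5 * (21 / 20 * q * (21 / 200))"
  proof (rule mult_mono)
    have "\<bar>Re \<omega>\<bar> \<le> 21 / 200"
      using abs_Re_le_cmod[of \<omega>] n\<omega> q by linarith
    then have "exp \<bar>Re \<omega>\<bar> \<le> 1 + \<bar>Re \<omega>\<bar> + \<bar>Re \<omega>\<bar>\<^sup>2"
      by (intro exp_bound) auto
    also have "\<dots> \<le> 1 + 21 / 200 + (21 / 200)\<^sup>2"
      using \<open>\<bar>Re \<omega>\<bar> \<le> 21 / 200\<close> by (intro add_mono power_mono) auto
    finally show "exp \<bar>Re \<omega>\<bar> \<le> 6 / 5"
      by (simp add: power2_eq_square)
    show "(norm \<omega>)\<^sup>2 \<le> 21 / 20 * q * (21 / 200)"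
      unfolding power2_eq_square using n\<omega> q q0 by (intro mult_mono) auto
  qed auto
  also have "\<dots> \<le> 3 / 20 * q"
    using q0 by simp
  finally have e2: "norm (exp \<omega> - 1 - \<omega>) \<le> 3 / 20 * q" .
  define e where "e = (exp \<omega> - 1 - \<omega>) + (\<omega> + of_real (rdecay x) * \<zeta>)"
  show "norm e \<le> \<bar>y\<bar> * rdecay x / 5"
    using norm_triangle_ineq[of "exp \<omega> - 1 - \<omega>" "\<omega> + of_real (rdecay x) * \<zeta>"] e1 e2
    unfolding e_def q_def by simp
  have "\<bar>Im (of_real x + \<zeta>)\<bar> < pi / 2"
    using regular_distortion(1)[OF assms(1), of \<zeta>] n assms(2) by simp
  then have "speed (Complex x y) = exp (log_speed (of_real x) + \<omega>)"
    unfolding xy by (simp add: exp_log_speed \<omega>_def)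
  also have "\<dots> = speed (of_real x) * exp \<omega>"
    by (simp add: exp_add exp_log_speed)
  also have "exp \<omega> = 1 - \<i> * of_real (y * rdecay x) + e"
    by (simp add: e_def \<zeta>_def mult.commute)
  finally show "speed (Complex x y) = of_real (rspeed x) * (1 - \<i> * of_real (y * rdecay x) + e)"
    by (simp add: speed_of_real)
qed

definition channel :: "complex set" where
  "channel = {z. 0 < Re z \<and> \<bar>Im z\<bar> < width (Re z)}"

text \<open>
  The constant factor ensures that a step is shorter than the width of the channel, so that
  the speed is under control along the whole step.
\<close>
definition step :: "complex \<Rightarrow> complex" where
  "step z = of_real (aperture / 4) * speed z"

definition rstep :: "real \<Rightarrow> real" where
  "rstep x = aperture / 4 * rspeed x"

lemma rstep_pos: "0 < rstep x"
  using rspeed_pos[of x] by (simp add: rstep_def aperture_def)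

lemma step_of_real: "step (of_real x) = of_real (rstep x)"
  by (simp add: step_def rstep_def speed_of_real)

lemma rstep_le_width:
  assumes "0 \<le> x"
  shows "11 / 10 * rstep x \<le> width x"
proof -
  have "sqrt (rspeed x) \<le> sqrt (2\<^sup>2)"
    using rspeed_le_2[OF assms] by (intro real_sqrt_le_mono) auto
  then have "sqrt (rspeed x) * sqrt (rspeed x) \<le> 2 * sqrt (rspeed x)"
    using rspeed_pos[of x] by (intro mult_right_mono) auto
  then have "rspeed x \<le> 2 * sqrt (rspeed x)"
    using rspeed_pos[of x] by simp
  then have "11 / 10 * (1 / 4 * rspeed x) \<le> sqrt (rspeed x)"
    using rspeed_pos[of x] real_sqrt_gt_zero[of "rspeed x"] by linarith
  then have "aperture * (11 / 10 * (1 / 4 * rspeed x)) \<le> aperture * sqrt (rspeed x)"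
    by (intro mult_left_mono) (auto simp: aperture_def)
  then show ?thesis
    by (simp add: rstep_def width_def mult_ac)
qed

text \<open>
  One step multiplies \<open>|Im z|\<close> by at most \<open>1 - (4/5) h L\<close>, where \<open>h\<close> is the step length and \<open>L\<close> the decay
  rate at \<open>Re z\<close>. The real part advances by at most \<open>(11/10) h\<close>, so the square root of the speed loses
  at most the factor \<open>exp(- (231/400) h L)\<close>. As \<open>231/400 < 4/5\<close>, the channel is invariant.
\<close>
lemma channel_step:
  assumes "z \<in> channel"
  shows "z + step z \<in> channel" and "9 / 10 * rstep (Re z) \<le> Re (step z)"
proof -
  define x y where "x = Re z" and "y = Im z"
  have z: "z = Complex x y"
    by (simp add: x_def y_def)
  have x: "0 < x" and y: "\<bar>y\<bar> < width x"
    using assms by (auto simp: channel_def x_def y_def)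
  define h L where "h = rstep x" and "L = rdecay x"
  have h: "0 < h" and L: "0 < L"
    by (auto simp: h_def L_def rstep_pos rdecay_pos)
  have x': "0 \<le> x" and y': "\<bar>y\<bar> \<le> width x"
    using x y by simp_all
  obtain e where e: "speed (Complex x y) = of_real (rspeed x) * (1 - \<i> * of_real (y * L) + e)"
    "norm e \<le> \<bar>y\<bar> * L / 5"
    unfolding L_def by (rule speed_vertical[OF x' y'])
  have wL: "width x * L \<le> 1 / 10"
    unfolding L_def by (rule width_rdecay_le[OF x'])
  have yL: "\<bar>y\<bar> * L \<le> 1 / 10"
    by (rule order_trans[OF mult_right_mono wL]) (use y' L in auto)
  have hw: "11 / 10 * h \<le> width x"
    using rstep_le_width[of x] x by (simp add: h_def)
  have hL: "h * L \<le> 1 / 10"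
    by (rule order_trans[OF mult_right_mono wL]) (use hw h L in auto)
  have step: "step z = of_real h * (1 - \<i> * of_real (y * L) + e)"
    unfolding z step_def e(1) by (simp add: h_def rstep_def)
  have e_small: "norm e \<le> 1 / 50"
    using e(2) yL by simp
  have Re_step: "Re (step z) = h * (1 + Re e)" and Im_step: "Im (step z) = h * (Im e - y * L)"
    unfolding step by simp_all
  define u where "u = Re (step z)"
  have u: "9 / 10 * h \<le> u" "u \<le> 11 / 10 * h"
    using abs_Re_le_cmod[of e] e_small h unfolding u_def Re_step
    by (simp_all add: mult.commute[of _ h] mult_left_mono)
  then show "9 / 10 * rstep (Re z) \<le> Re (step z)"
    by (simp add: u_def h_def x_def)
  have u0: "0 < u" "u \<le> width x"
    using u h hw by linarith+
  have "\<bar>Im (z + step z)\<bar> = \<bar>y * (1 - h * L) + h * Im e\<bar>"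
    unfolding plus_complex.sel Im_step y_def[symmetric] by (simp add: algebra_simps)
  also have "\<dots> \<le> \<bar>y\<bar> * (1 - h * L) + h * (\<bar>y\<bar> * L / 5)"
  proof (rule order_trans[OF abs_triangle_ineq add_mono])
    show "\<bar>y * (1 - h * L)\<bar> \<le> \<bar>y\<bar> * (1 - h * L)"
      using hL by (simp add: abs_mult)
    show "\<bar>h * Im e\<bar> \<le> h * (\<bar>y\<bar> * L / 5)"
      using abs_Im_le_cmod[of e] e(2) h by (simp add: abs_mult)
  qed
  also have "\<dots> = \<bar>y\<bar> * (1 + (- (4 / 5 * (h * L))))"
    by (simp add: algebra_simps)
  also have "\<dots> \<le> \<bar>y\<bar> * exp (- (4 / 5 * (h * L)))"
    by (intro mult_left_mono exp_ge_add_one_self) simp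
  also have "\<dots> < width x * exp (- (4 / 5 * (h * L)))"
    using y by (intro mult_strict_right_mono) auto
  also have "\<dots> \<le> width x * exp (- (21 / 40 * (L * u)))"
  proof -
    have "L * u \<le> L * (11 / 10 * h)"
      using u L by (intro mult_left_mono) auto
    moreover have "0 < h * L"
      using h L by simp
    ultimately have "21 / 40 * (L * u) \<le> 4 / 5 * (h * L)"
      by (simp add: mult.commute)
    then show ?thesis
      using width_pos[of x] by simp
  qed
  also have "\<dots> \<le> width (x + u)"
  proof -
    have "rspeed x * exp (- (21 / 20 * (L * u))) \<le> rspeed (x + u)"
      unfolding L_def using x u0 by (intro rspeed_shift_ge) auto
    moreover have "exp (- (21 / 20 * (L * u))) = (exp (- (21 / 40 * (L * u))))\<^sup>2"
      by (simp flip: exp_double)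
    ultimately have "sqrt (rspeed x * (exp (- (21 / 40 * (L * u))))\<^sup>2) \<le> sqrt (rspeed (x + u))"
      by simp
    then have "sqrt (rspeed x) * exp (- (21 / 40 * (L * u))) \<le> sqrt (rspeed (x + u))"
      by (simp add: real_sqrt_mult)
    then have "aperture * (sqrt (rspeed x) * exp (- (21 / 40 * (L * u)))) \<le> aperture * sqrt (rspeed (x + u))"
      by (intro mult_left_mono) (auto simp: aperture_def)
    then show ?thesis
      by (simp add: width_def mult.assoc)
  qed
  finally have "\<bar>Im (z + step z)\<bar> < width (x + u)" .
  then show "z + step z \<in> channel"
    using x u0 unfolding channel_def by (simp add: x_def u_def)
qed

lemma open_channel: "open channel"
proof -
  have "continuous_on UNIV speed"
    by (rule holomorphic_on_imp_continuous_on[OF holomorphic_speed])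
  moreover have "continuous_on UNIV (\<lambda>z. complex_of_real (Re z))"
    by (intro continuous_on_of_real continuous_on_Re continuous_on_id)
  ultimately have "continuous_on UNIV (\<lambda>z. speed (of_real (Re z)))"
    by (rule continuous_on_compose2) simp
  then have "continuous_on UNIV (\<lambda>z. norm (speed (of_real (Re z))))"
    by (rule continuous_on_norm)
  then have cont: "continuous_on UNIV (\<lambda>z. width (Re z))"
    unfolding norm_speed_of_real width_def
    by (intro continuous_on_mult continuous_on_const continuous_on_real_sqrt)
  show ?thesis
    unfolding channel_def
    by (intro open_Collect_conj open_Collect_less cont continuous_on_const continuous_on_Re
        continuous_on_Im continuous_on_rabs continuous_on_id)
qed

lemma real_in_channel: "0 < x \<Longrightarrow> of_real x \<in> channel"
  by (simp add: channel_def width_pos)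

lemma holomorphic_step: "step holomorphic_on A"
  unfolding step_def[abs_def] by (intro holomorphic_intros holomorphic_speed)

lemma step_odd_pi_i: "step (odd_pi_i k) = 0"
  by (simp add: step_def speed_def exp_minus_odd_pi_i)

end

section \<open>From a real orbit to a Baker domain\<close>

lemma uniform_escape_of_drift:
  assumes inv: "\<And>z. z \<in> D \<Longrightarrow> f z \<in> D" and right: "\<And>z. z \<in> D \<Longrightarrow> 0 \<le> Re z"
    and drift: "\<And>X. \<exists>\<epsilon>>0. \<forall>z\<in>D. Re z \<le> X \<longrightarrow> Re z + \<epsilon> \<le> Re (f z)"
  shows "\<forall>\<^sub>F n in sequentially. \<forall>w\<in>D. K \<le> cmod ((f ^^ n) w)"
proof -
  obtain \<epsilon> where \<epsilon>: "\<epsilon> > 0" "\<And>z. z \<in> D \<Longrightarrow> Re z \<le> K \<Longrightarrow> Re z + \<epsilon> \<le> Re (f z)"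
    using drift[of K] by blast
  have mono: "Re z \<le> Re (f z)" if "z \<in> D" for z
  proof -
    obtain \<delta> where "\<delta> > 0" "\<forall>w\<in>D. Re w \<le> Re z \<longrightarrow> Re w + \<delta> \<le> Re (f w)"
      using drift[of "Re z"] by blast
    then show ?thesis
      using that by (smt (verit))
  qed
  have orbit: "(f ^^ n) w \<in> D \<and> min K (real n * \<epsilon>) \<le> Re ((f ^^ n) w)" if w: "w \<in> D" for n w
  proof (induction n)
    case 0
    then show ?case
      using w right[OF w] by (simp add: min_le_iff_disj)
  next
    case (Suc n)
    define z where "z = (f ^^ n) w"
    have z: "z \<in> D" "min K (real n * \<epsilon>) \<le> Re z"
      using Suc by (simp_all add: z_def)
    have "min K (real (Suc n) * \<epsilon>) \<le> Re (f z)"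
    proof (cases "K \<le> Re z")
      case True
      then show ?thesis
        using mono[OF z(1)] by simp
    next
      case False
      then have "real n * \<epsilon> \<le> Re z"
        using z(2) by linarith
      then have "real (Suc n) * \<epsilon> \<le> Re (f z)"
        using \<epsilon>(2)[OF z(1)] False by (simp add: algebra_simps)
      then show ?thesis
        by simp
    qed
    then show ?case
      using inv[OF z(1)] by (simp add: z_def)
  qed
  obtain n0 :: nat where n0: "K / \<epsilon> \<le> real n0"
    using real_arch_simple by blast
  show ?thesis
    unfolding eventually_sequentially
  proof (intro exI[of _ n0] allI impI ballI)
    fix n w
    assume n: "n0 \<le> n" and w: "w \<in> D"
    have "K / \<epsilon> \<le> real n"
      using n n0 by simp
    then have "K \<le> real n * \<epsilon>"
      using \<epsilon>(1) by (simp add: field_simps)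
    then show "K \<le> cmod ((f ^^ n) w)"
      using orbit[OF w, of n] complex_Re_le_cmod[of "(f ^^ n) w"] by linarith
  qed
qed

lemma baker_domain_of_real_step:
  assumes holo: "h holomorphic_on UNIV" and zero: "\<And>k. h (odd_pi_i k) = 0"
    and D: "open D" "\<And>z. z \<in> D \<Longrightarrow> 0 \<le> Re z \<and> z + h z \<in> D"
    and drift: "\<And>X. \<exists>\<epsilon>>0. \<forall>z\<in>D. Re z \<le> X \<longrightarrow> \<epsilon> \<le> Re (h z)"
    and real: "\<And>x. h (of_real x) = of_real (H x)" "\<And>x. 1 < x \<Longrightarrow> of_real x \<in> D"
    and a: "filterlim a at_top sequentially"
    and rate: "grows_like a (\<lambda>n. ((\<lambda>x. x + H x) ^^ n) 2)"
  obtains f U where "transcendental_entire f" "baker_domain f U"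
    "\<And>z. z \<in> U \<Longrightarrow> grows_like a (\<lambda>n. cmod ((f ^^ n) z))"
proof -
  define f where "f z = z + h z" for z
  define L :: "complex set" where "L = of_real ` {1<..}"
  have H: "0 \<le> H x" if "1 < x" for x
  proof -
    obtain \<epsilon> where "\<epsilon> > 0" "\<forall>z\<in>D. Re z \<le> x \<longrightarrow> \<epsilon> \<le> Re (h z)"
      using drift[of x] by blast
    then have "\<epsilon> \<le> Re (h (of_real x))"
      using real(2)[OF that] by simp
    then show ?thesis
      using \<open>\<epsilon> > 0\<close> by (simp add: real)
  qed
  have f_real: "f (of_real x) = of_real (x + H x)" for x
    by (simp add: f_def real)
  have orbit: "(f ^^ n) 2 = of_real (((\<lambda>x. x + H x) ^^ n) 2)" for n
    by (induction n) (simp_all only: funpow.simps o_apply id_apply f_real of_real_numeral)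
  have pos: "0 \<le> ((\<lambda>x. x + H x) ^^ n) 2" for n
  proof -
    have "2 \<le> ((\<lambda>x. x + H x) ^^ n) 2"
    proof (induction n)
      case (Suc n)
      then show ?case
        using H[of "((\<lambda>x. x + H x) ^^ n) 2"] by simp
    qed simp
    then show ?thesis
      by simp
  qed
  show ?thesis
  proof (rule baker_domain_of_escaping_region[where f = f and D = D and L = L and p = 2 and a = a])
    show "f holomorphic_on UNIV"
      unfolding f_def[abs_def] by (intro holomorphic_intros holo)
    show "f (odd_pi_i k) = odd_pi_i k" for k
      by (simp add: f_def zero)
    show "\<forall>\<^sub>F n in sequentially. \<forall>w\<in>D. K \<le> cmod ((f ^^ n) w)" for K
    proof (rule uniform_escape_of_drift)
      show "\<exists>\<epsilon>>0. \<forall>z\<in>D. Re z \<le> X \<longrightarrow> Re z + \<epsilon> \<le> Re (f z)" for X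
        using drift[of X] by (simp add: f_def)
    qed (use D(2) in \<open>auto simp: f_def\<close>)
    have "connected ({1<..} :: real set)"
      by (simp add: connected_iff_interval)
    then show "connected L"
      unfolding L_def by (intro connected_continuous_image continuous_on_of_real continuous_on_id)
    show "f ` L \<subseteq> L"
    proof
      fix w
      assume "w \<in> f ` L"
      then obtain x where "1 < x" "w = f (of_real x)"
        by (auto simp: L_def)
      then show "w \<in> L"
        unfolding L_def using H[of x] f_real by (intro image_eqI[of _ _ "x + H x"]) auto
    qed
    have "complex_of_real 2 \<in> L"
      unfolding L_def by (intro imageI) simp
    then show "2 \<in> L"
      by simp
    show "grows_like a (\<lambda>n. cmod ((f ^^ n) 2))"
      using rate pos by (simp add: orbit)
  qed (use D(1) real(2) a that in \<open>auto simp: L_def\<close>)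
qed

text \<open>
  Where \<open>x\<close> is well ahead of \<open>a\<close> it is not much faster than \<open>a\<close>, and where it is behind it is not much
  slower. Hence \<open>\<rho> a - T \<le> x \<le> \<kappa> a + S\<close> by induction, and the additive constants disappear
  since \<open>a\<close> tends to infinity.
\<close>
lemma grows_like_by_comparison:
  fixes a x :: "nat \<Rightarrow> real"
  assumes a: "filterlim a at_top sequentially" and a_nonneg: "\<And>n. 0 \<le> a n"
    and a_inc: "\<And>n. n \<ge> start \<Longrightarrow> a n < a (Suc n) \<and> a (Suc n) \<le> a n + A"
    and x_inc: "\<And>n. x n \<le> x (Suc n) \<and> x (Suc n) \<le> x n + B"
    and up: "\<And>n. n \<ge> start \<Longrightarrow> a n + 2 \<le> x n \<Longrightarrow> x (Suc n) - x n \<le> \<kappa> * (a (Suc n) - a n)"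
    and low: "\<And>n. n \<ge> start \<Longrightarrow> x n \<le> a n \<Longrightarrow> \<rho> * (a (Suc n) - a n) \<le> x (Suc n) - x n"
    and \<kappa>: "1 \<le> \<kappa>" and \<rho>: "0 < \<rho>" "\<rho> \<le> 1"
  shows "grows_like a x"
proof -
  define S where "S = max (x start - \<kappa> * a start) (2 + B)"
  define T where "T = max (\<rho> * a start - x start) A"
  have upper: "x n \<le> \<kappa> * a n + S" if "n \<ge> start" for n
    using that
  proof (induction n rule: dec_induct)
    case base
    then show ?case
      by (simp add: S_def)
  next
    case (step n)
    show ?case
    proof (cases "a n + 2 \<le> x n")
      case True
      have "x (Suc n) \<le> (\<kappa> * a n + S) + \<kappa> * (a (Suc n) - a n)"
        using up[OF step(1) True] step.IH by linarith
      then show ?thesis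
        by (simp add: algebra_simps)
    next
      case False
      have "1 * a (Suc n) \<le> \<kappa> * a (Suc n)"
        using \<kappa> a_nonneg by (intro mult_right_mono) auto
      then show ?thesis
        using False x_inc[of n] a_inc[OF step(1)] unfolding S_def by linarith
    qed
  qed
  have lower: "\<rho> * a n - T \<le> x n" if "n \<ge> start" for n
    using that
  proof (induction n rule: dec_induct)
    case base
    then show ?case
      by (simp add: T_def)
  next
    case (step n)
    show ?case
    proof (cases "x n \<le> a n")
      case True
      have "(\<rho> * a n - T) + \<rho> * (a (Suc n) - a n) \<le> x (Suc n)"
        using low[OF step(1) True] step.IH by linarith
      then show ?thesis
        by (simp add: algebra_simps)
    next
      case False
      have "\<rho> * a (Suc n) \<le> 1 * a (Suc n)"
        using \<rho> a_nonneg by (intro mult_right_mono) auto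
      then show ?thesis
        using False x_inc[of n] a_inc[OF step(1)] unfolding T_def by linarith
    qed
  qed
  define C where "C = \<kappa> + 1 + 2 / \<rho>"
  have C: "1 < C" "\<kappa> + 1 \<le> C" "2 / \<rho> \<le> C"
    using \<kappa> \<rho> divide_pos_pos[of 2 \<rho>] unfolding C_def by linarith+
  have "\<forall>\<^sub>F n in sequentially. max S (2 * T / \<rho>) \<le> a n"
    using a unfolding filterlim_at_top by (rule allE)
  then obtain N where N: "\<And>n. n \<ge> N \<Longrightarrow> max S (2 * T / \<rho>) \<le> a n"
    unfolding eventually_sequentially by blast
  have "a n / C \<le> x n \<and> x n \<le> C * a n" if n: "n \<ge> max N start" for n
  proof
    have aS: "S \<le> a n" and aT: "2 * T / \<rho> \<le> a n"
      using N[of n] n by auto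
    have "x n \<le> (\<kappa> + 1) * a n"
      using upper[of n] n aS by (simp add: algebra_simps)
    also have "\<dots> \<le> C * a n"
      using C(2) a_nonneg by (intro mult_right_mono) auto
    finally show "x n \<le> C * a n" .
    have "T \<le> \<rho> * a n / 2"
      using aT \<rho> by (simp add: field_simps)
    then have "\<rho> * a n / 2 \<le> x n"
      using lower[of n] n by linarith
    moreover have "a n / C \<le> a n / (2 / \<rho>)"
      using C(1,3) \<rho> a_nonneg by (intro divide_left_mono mult_pos_pos) auto
    moreover have "a n / (2 / \<rho>) = \<rho> * a n / 2"
      by simp
    ultimately show "a n / C \<le> x n"
      by linarith
  qed
  then show ?thesis
    unfolding grows_like_def using C(1) by blast
qed

text \<open>
  Here \<open>a\<close> grows linearly, and so do the orbits of \<open>z + 1 + e\<^sup>-\<^sup>z\<close> in the half-plane \<open>Re z > 1\<close>.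
\<close>
lemma baker_domain_of_bounded_gaps:
  assumes a: "filterlim a at_top sequentially" and a_nonneg: "\<And>n. 0 \<le> a n"
    and gaps: "\<And>n. n \<ge> start \<Longrightarrow> \<epsilon> \<le> a (Suc n) - a n \<and> a (Suc n) - a n \<le> A" and "0 < \<epsilon>"
  obtains f U where "transcendental_entire f" "baker_domain f U"
    "\<And>z. z \<in> U \<Longrightarrow> grows_like a (\<lambda>n. cmod ((f ^^ n) z))"
proof -
  define h :: "complex \<Rightarrow> complex" where "h z = 1 + exp (- z)" for z
  define H :: "real \<Rightarrow> real" where "H x = 1 + exp (- x)" for x
  define D where "D = {z. 1 < Re z}"
  define x where "x n = ((\<lambda>x. x + H x) ^^ n) 2" for n
  have xS: "x (Suc n) = x n + H (x n)" for n
    by (simp add: x_def)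
  have x0: "0 \<le> x n" for n
  proof (induction n)
    case (Suc n)
    then show ?case
      by (simp add: xS H_def add_nonneg_nonneg)
  qed (simp add: x_def)
  have H: "1 \<le> H (x n)" "H (x n) \<le> 2" for n
    using x0[of n] by (simp_all add: H_def)
  have A: "0 < A"
    using gaps[of start] \<open>0 < \<epsilon>\<close> by simp
  have rate: "grows_like a x"
  proof (rule grows_like_by_comparison[where start = start and A = A and B = 2 and \<kappa> = "max 1 (2 / \<epsilon>)"
        and \<rho> = "min 1 (1 / A)"])
    show "a n < a (Suc n) \<and> a (Suc n) \<le> a n + A" if "start \<le> n" for n
      using gaps[OF that] \<open>0 < \<epsilon>\<close> by simp
    show "x n \<le> x (Suc n) \<and> x (Suc n) \<le> x n + 2" for n
      using H[of n] by (simp add: xS)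
    show "x (Suc n) - x n \<le> max 1 (2 / \<epsilon>) * (a (Suc n) - a n)" if "start \<le> n" for n
    proof -
      have "2 / \<epsilon> * \<epsilon> \<le> max 1 (2 / \<epsilon>) * (a (Suc n) - a n)"
        using gaps[OF that] \<open>0 < \<epsilon>\<close> by (intro mult_mono) auto
      then show ?thesis
        using H[of n] \<open>0 < \<epsilon>\<close> by (simp add: xS)
    qed
    show "min 1 (1 / A) * (a (Suc n) - a n) \<le> x (Suc n) - x n" if "start \<le> n" for n
    proof -
      have "min 1 (1 / A) * (a (Suc n) - a n) \<le> 1 / A * A"
        using gaps[OF that] \<open>0 < \<epsilon>\<close> A by (intro mult_mono) auto
      then show ?thesis
        using H[of n] A by (simp add: xS)
    qed
  qed (use a a_nonneg A in auto)
  have Re_h: "1 - exp (- 1) \<le> Re (h z)" if "z \<in> D" for z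
  proof -
    have "norm (exp (- z)) \<le> exp (- 1)"
      using that by (simp add: D_def)
    moreover have "Re (h z) = 1 + Re (exp (- z))"
      by (simp add: h_def)
    ultimately show ?thesis
      using abs_Re_le_cmod[of "exp (- z)"] by linarith
  qed
  have c: "0 < 1 - exp (- 1 :: real)"
    by simp
  show ?thesis
  proof (rule baker_domain_of_real_step[where h = h and D = D and H = H and a = a])
    show "h holomorphic_on UNIV"
      unfolding h_def[abs_def] by (intro holomorphic_intros)
    show "h (odd_pi_i k) = 0" for k
      by (simp add: h_def exp_minus_odd_pi_i)
    show "open D"
      unfolding D_def by (intro open_halfspace_Re_gt)
    show "0 \<le> Re z \<and> z + h z \<in> D" if "z \<in> D" for z
      using that Re_h[OF that] c unfolding D_def mem_Collect_eq plus_complex.sel by linarith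
    show "\<exists>\<epsilon>>0. \<forall>z\<in>D. Re z \<le> X \<longrightarrow> \<epsilon> \<le> Re (h z)" for X
      using Re_h c by blast
    show "h (of_real x) = of_real (H x)" for x
      by (simp add: h_def H_def flip: exp_of_real)
    show "grows_like a (\<lambda>n. ((\<lambda>x. x + H x) ^^ n) 2)"
      using rate unfolding x_def[abs_def] .
  qed (use a that in \<open>auto simp: D_def\<close>)
qed

lemma exp_neg_four: "exp (- 4 :: real) ^ i = exp (- (4 * real i))"
  by (simp add: mult.commute flip: exp_of_nat_mult)

lemma (in speed_steps) aperture_small: "aperture / 4 \<le> 1 / 2"
proof -
  have "aperture \<le> 1 / (41 * 16 * 1)"
    unfolding aperture_def by (intro divide_left_mono mult_left_mono) auto
  then show ?thesis
    by simp
qed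

lemma (in speed_steps) rstep_le:
  assumes "0 \<le> x" "l i \<le> x"
  shows "rstep x \<le> exp 8 * exp (- 4) ^ i"
proof -
  have "aperture / 4 * rspeed x \<le> 1 / 2 * (2 * exp (8 - 4 * real i))"
    using rspeed_pos[of x] by (intro mult_mono rspeed_le assms aperture_small) auto
  then show ?thesis
    by (simp add: rstep_def exp_neg_four flip: exp_add)
qed

lemma (in speed_steps) rstep_ge:
  assumes "x \<le> l i"
  shows "aperture / 4 * exp (- 28) * exp (- 4) ^ i \<le> rstep x"
proof -
  have "aperture / 4 * exp (- 28 - 4 * real i) \<le> aperture / 4 * rspeed x"
    by (intro mult_left_mono rspeed_ge assms) (simp add: aperture_def)
  then show ?thesis
    by (simp add: rstep_def exp_neg_four mult.assoc flip: exp_add)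
qed

text \<open>
  The hypothesis on the levels says that \<open>a\<close> has gaps of size about \<open>A e\<^sup>-\<^sup>4\<^sup>i\<close> while it runs from about
  \<open>l i\<close> to about \<open>l (i + 1)\<close>. The speed on that interval has the same size up to a constant.
\<close>
theorem (in speed_steps) baker_domain_of_steps:
  assumes a: "filterlim a at_top sequentially" and a_nonneg: "\<And>n. 0 \<le> a n"
    and a_inc: "\<And>n. n \<ge> start \<Longrightarrow> a n < a (Suc n) \<and> a (Suc n) \<le> a n + A" and A: "0 < A"
    and level: "\<And>n. n \<ge> start \<Longrightarrow> \<exists>i. l i \<le> a n + 2 \<and> a n \<le> l (Suc i) \<and>
        A * exp (- 4) ^ Suc i \<le> a (Suc n) - a n \<and> a (Suc n) - a n \<le> A * exp (- 4) ^ i"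
  obtains f U where "transcendental_entire f" "baker_domain f U"
    "\<And>z. z \<in> U \<Longrightarrow> grows_like a (\<lambda>n. cmod ((f ^^ n) z))"
proof -
  define x where "x n = ((\<lambda>x. x + rstep x) ^^ n) 2" for n
  have xS: "x (Suc n) = x n + rstep (x n)" for n
    by (simp add: x_def)
  have x0: "0 \<le> x n" for n
  proof (induction n)
    case (Suc n)
    then show ?case
      using rstep_pos[of "x n"] by (simp add: xS)
  qed (simp add: x_def)
  define c where "c = aperture / 4 * exp (- 28)"
  have c: "0 < c"
    by (simp add: c_def aperture_def)
  define \<kappa> where "\<kappa> = exp 8 * exp 4 / A"
  define \<rho> where "\<rho> = c * exp (- 4) / A"
  have \<kappa>: "0 < \<kappa>" and \<rho>: "0 < \<rho>"
    using A c by (simp_all add: \<kappa>_def \<rho>_def)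
  have rate: "grows_like a x"
  proof (rule grows_like_by_comparison[where start = start and A = A and B = 1 and \<kappa> = "max 1 \<kappa>"
        and \<rho> = "min 1 \<rho>"])
    have "rstep (x n) \<le> 1" for n
    proof -
      have "aperture / 4 * rspeed (x n) \<le> 1 / 2 * 2"
        using rspeed_pos[of "x n"] by (intro mult_mono rspeed_le_2 x0 aperture_small) auto
      then show ?thesis
        by (simp add: rstep_def)
    qed
    then show "x n \<le> x (Suc n) \<and> x (Suc n) \<le> x n + 1" for n
      using rstep_pos[of "x n"] by (simp add: xS less_imp_le)
    show "x (Suc n) - x n \<le> max 1 \<kappa> * (a (Suc n) - a n)" if n: "start \<le> n" "a n + 2 \<le> x n" for n
    proof -
      obtain i where i: "l i \<le> a n + 2" "A * exp (- 4) ^ Suc i \<le> a (Suc n) - a n"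
        using level[OF n(1)] by blast
      have "rstep (x n) \<le> exp 8 * exp (- 4) ^ i"
        using i(1) n(2) x0 by (intro rstep_le) auto
      also have "\<dots> = \<kappa> * (A * exp (- 4) ^ Suc i)"
        using A by (simp add: \<kappa>_def exp_minus field_simps)
      also have "\<dots> \<le> max 1 \<kappa> * (a (Suc n) - a n)"
        using i(2) A \<kappa> by (intro mult_mono) auto
      finally show ?thesis
        by (simp add: xS)
    qed
    show "min 1 \<rho> * (a (Suc n) - a n) \<le> x (Suc n) - x n" if n: "start \<le> n" "x n \<le> a n" for n
    proof -
      obtain i where i: "a n \<le> l (Suc i)" "a (Suc n) - a n \<le> A * exp (- 4) ^ i"
        using level[OF n(1)] by blast
      have "min 1 \<rho> * (a (Suc n) - a n) \<le> \<rho> * (A * exp (- 4) ^ i)"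
        using i(2) a_inc[OF n(1)] \<rho> by (intro mult_mono) auto
      also have "\<dots> = c * exp (- 4) ^ Suc i"
        using A by (simp add: \<rho>_def)
      also have "\<dots> \<le> rstep (x n)"
        unfolding c_def using i(1) n(2) by (intro rstep_ge) auto
      finally show ?thesis
        by (simp add: xS)
    qed
  qed (use a a_nonneg a_inc \<rho> in auto)
  have drift: "\<exists>\<epsilon>>0. \<forall>z\<in>channel. Re z \<le> X \<longrightarrow> \<epsilon> \<le> Re (step z)" for X
  proof -
    have "\<exists>i. X \<le> l i"
      using l_top by (auto simp: filterlim_at_top eventually_sequentially)
    then obtain i where i: "X \<le> l i"
      by blast
    have "9 / 10 * (c * exp (- 4) ^ i) \<le> Re (step z)" if z: "z \<in> channel" "Re z \<le> X" for z
    proof -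
      have "c * exp (- 4) ^ i \<le> rstep (Re z)"
        unfolding c_def using z(2) i by (intro rstep_ge) auto
      then show ?thesis
        using channel_step(2)[OF z(1)] by linarith
    qed
    then show ?thesis
      using c by (intro exI[of _ "9 / 10 * (c * exp (- 4) ^ i)"]) auto
  qed
  show ?thesis
  proof (rule baker_domain_of_real_step[where h = step and D = channel and H = rstep and a = a])
    show "0 \<le> Re z \<and> z + step z \<in> channel" if "z \<in> channel" for z
      using channel_step(1)[OF that] that by (simp add: channel_def)
    show "grows_like a (\<lambda>n. ((\<lambda>x. x + rstep x) ^^ n) 2)"
      using rate unfolding x_def[abs_def] .
    show "of_real x \<in> channel" if "1 < x" for x
      using that by (intro real_in_channel) simp
  qed (use holomorphic_step step_odd_pi_i open_channel drift step_of_real a that in auto)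
qed

text \<open>
  \<open>N i\<close> is the first index at which the gap is at most \<open>A e\<^sup>-\<^sup>4\<^sup>i\<close>. Several of these indices may coincide;
  the shift by \<open>2 - 2 (1/2)\<^sup>i\<close> keeps the places apart and changes each of them by less than \<open>2\<close>.
\<close>
lemma baker_domain_of_vanishing_gaps:
  fixes a :: "nat \<Rightarrow> real" and d :: "nat \<Rightarrow> real"
  assumes a: "filterlim a at_top sequentially" and a_nonneg: "\<And>n. 0 \<le> a n" and "strict_mono a"
    and d: "\<And>n. d n = a (Suc n) - a n"
    and decr: "\<And>n. n \<ge> start \<Longrightarrow> d (Suc n) \<le> d n"
    and small: "\<And>\<epsilon>. 0 < \<epsilon> \<Longrightarrow> \<exists>n\<ge>start. d n \<le> \<epsilon>"
  obtains f U where "transcendental_entire f" "baker_domain f U"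
    "\<And>z. z \<in> U \<Longrightarrow> grows_like a (\<lambda>n. cmod ((f ^^ n) z))"
proof -
  have d_pos: "0 < d n" for n
    using strict_monoD[OF \<open>strict_mono a\<close>, of n "Suc n"] by (simp add: d)
  have d_mono: "d n \<le> d m" if "start \<le> m" "m \<le> n" for m n
    using that(2,1)
  proof (induction n rule: dec_induct)
    case (step n)
    then show ?case
      using decr[of n] by simp
  qed simp
  define A where "A = d start"
  have A: "0 < A"
    by (simp add: A_def d_pos)
  define N where "N i = (LEAST n. start \<le> n \<and> d n \<le> A * exp (- 4) ^ i)" for i
  have N: "start \<le> N i" "d (N i) \<le> A * exp (- 4) ^ i" for i
  proof -
    have "\<exists>n. start \<le> n \<and> d n \<le> A * exp (- 4) ^ i"
      using small[of "A * exp (- 4) ^ i"] A by auto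
    from LeastI_ex[OF this] show "start \<le> N i" "d (N i) \<le> A * exp (- 4) ^ i"
      unfolding N_def by blast+
  qed
  have N_least: "A * exp (- 4) ^ i < d n" if "start \<le> n" "n < N i" for i n
    using not_less_Least[of n "\<lambda>n. start \<le> n \<and> d n \<le> A * exp (- 4) ^ i"] that
    unfolding N_def[symmetric] by auto
  have N_ge: "d n \<le> A * exp (- 4) ^ i" if "N i \<le> n" for i n
    using d_mono[OF N(1) that] N(2)[of i] by simp
  have N_0: "N 0 = start"
    unfolding N_def by (rule Least_equality) (auto simp: A_def)
  have N_mono: "N i \<le> N (Suc i)" for i
  proof (rule ccontr)
    assume "\<not> ?thesis"
    then have "A * exp (- 4) ^ i < d (N (Suc i))"
      using N(1) by (intro N_least) auto
    also have "\<dots> \<le> A * exp (- 4) ^ Suc i"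
      by (rule N(2))
    also have "\<dots> \<le> A * exp (- 4) ^ i"
      using A by (intro mult_left_mono power_decreasing) auto
    finally show False
      by simp
  qed
  have beyond: "\<exists>j. n < N j" if "start \<le> n" for n
  proof -
    have "(\<lambda>i. A * exp (- 4 :: real) ^ i) \<longlonglongrightarrow> A * 0"
      by (intro tendsto_mult tendsto_const LIMSEQ_realpow_zero) auto
    then have "\<forall>\<^sub>F i in sequentially. A * exp (- 4) ^ i < d n"
      using d_pos[of n] by (intro order_tendstoD) auto
    then obtain j where "A * exp (- 4) ^ j < d n"
      by (auto simp: eventually_sequentially)
    then show ?thesis
      using N_ge[of j n] by (meson not_le)
  qed
  define l where "l i = a (N i) + 2 - 2 * (1 / 2) ^ i" for i
  have l_le: "l i \<le> a (N i) + 2" and l_ge: "a (N i) \<le> l i" for i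
    unfolding l_def by (simp_all add: power_le_one)
  interpret speed_steps l
  proof
    show "0 \<le> l 0"
      using a_nonneg by (simp add: l_def)
    show "l k + (1 / 2) ^ k \<le> l (Suc k)" for k
      using strict_mono_mono[OF \<open>strict_mono a\<close>] N_mono[of k] by (simp add: l_def monoD)
    show "filterlim l at_top sequentially"
      unfolding filterlim_at_top eventually_sequentially
    proof
      fix Z
      have "\<forall>\<^sub>F n in sequentially. Z \<le> a n"
        using a by (simp add: filterlim_at_top)
      then obtain n where n: "\<And>m. m \<ge> n \<Longrightarrow> Z \<le> a m"
        by (auto simp: eventually_sequentially)
      obtain j where j: "max n start < N j"
        using beyond[of "max n start"] by auto
      have "Z \<le> l i" if "j \<le> i" for i
      proof -
        have "N j \<le> N i"
          using lift_Suc_mono_le[of N] N_mono that by blast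
        then show ?thesis
          using n[of "N i"] j l_ge[of i] by linarith
      qed
      then show "\<exists>j. \<forall>i\<ge>j. Z \<le> l i"
        by blast
    qed
  qed
  show ?thesis
  proof (rule baker_domain_of_steps[where a = a and A = A and start = start])
    show "a n < a (Suc n) \<and> a (Suc n) \<le> a n + A" if "start \<le> n" for n
      using d_pos[of n] d_mono[OF order_refl that] by (simp add: d A_def)
    show "\<exists>i. l i \<le> a n + 2 \<and> a n \<le> l (Suc i) \<and>
        A * exp (- 4) ^ Suc i \<le> a (Suc n) - a n \<and> a (Suc n) - a n \<le> A * exp (- 4) ^ i"
      if n: "start \<le> n" for n
    proof -
      define j where "j = (LEAST j. n < N j)"
      have j: "n < N j"
        unfolding j_def using beyond[OF n] by (rule LeastI_ex)
      then obtain i where i: "j = Suc i"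
        using N_0 n by (cases j) auto
      have ni: "N i \<le> n"
        using not_less_Least[of i "\<lambda>j. n < N j"] i unfolding j_def[symmetric] by simp
      have "a (N i) \<le> a n" "a n \<le> a (N (Suc i))"
        using strict_mono_mono[OF \<open>strict_mono a\<close>] ni j i by (auto simp: monoD)
      then have "l i \<le> a n + 2" "a n \<le> l (Suc i)"
        using l_le[of i] l_ge[of "Suc i"] by linarith+
      moreover have "A * exp (- 4) ^ Suc i \<le> d n" "d n \<le> A * exp (- 4) ^ i"
        using N_least[OF n, of "Suc i"] j i N_ge[OF ni] by (auto simp: less_imp_le)
      ultimately show ?thesis
        unfolding d by blast
    qed
  qed (use a a_nonneg A that in auto)
qed

theorem theorem1p1:
  fixes a :: "nat \<Rightarrow> real" and n0 :: nat
  assumes "strict_mono a"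
    and "a 0 = 0"
    and "filterlim a at_top sequentially"
    and "n0 \<ge> 2"
    and "\<And>n. n \<ge> n0 \<Longrightarrow>
           1 \<le> (a (n - 1) - a (n - 2)) / (a n - a (n - 1)) \<and>
           (a (n - 1) - a (n - 2)) / (a n - a (n - 1)) < 2"
  shows "\<exists>(f :: complex \<Rightarrow> complex) U.
           transcendental_entire f \<and> baker_domain f U \<and>
           (\<forall>z\<in>U. \<exists>C::real. C > 1 \<and> (\<exists>N::nat. \<forall>n\<ge>N.
              a n / C \<le> cmod ((f ^^ n) z) \<and> cmod ((f ^^ n) z) \<le> C * a n))"
proof -
  define d where "d n = a (Suc n) - a n" for n
  have a_nonneg: "0 \<le> a n" for n
    using strict_mono_less_eq[OF assms(1), of 0 n] assms(2) by simp
  have d_pos: "0 < d n" for n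
    using strict_monoD[OF assms(1), of n "Suc n"] by (simp add: d_def)
  have decr: "d (Suc n) \<le> d n" if "n \<ge> n0 - 2" for n
  proof -
    have "1 \<le> d n / d (Suc n)"
      using assms(5)[of "Suc (Suc n)"] that by (simp add: d_def)
    then show ?thesis
      using d_pos[of "Suc n"] by (simp add: field_simps)
  qed
  have "\<exists>f U. transcendental_entire f \<and> baker_domain f U \<and>
      (\<forall>z\<in>U. grows_like a (\<lambda>n. cmod ((f ^^ n) z)))"
  \<comment> \<open>The condition on the ratios says that the gaps decrease from index \<open>n0 - 2\<close> on, so they either
    stay away from zero or tend to zero.\<close>
  proof (cases "\<exists>\<epsilon>>0. \<forall>n\<ge>n0 - 2. \<epsilon> < d n")
    case True
    then obtain \<epsilon> where \<epsilon>: "0 < \<epsilon>" "\<And>n. n \<ge> n0 - 2 \<Longrightarrow> \<epsilon> < d n"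
      by blast
    have d_le: "d n \<le> d (n0 - 2)" if "n \<ge> n0 - 2" for n
      using that
    proof (induction n rule: dec_induct)
      case (step n)
      then show ?case
        using decr[of n] by simp
    qed simp
    have "\<epsilon> \<le> a (Suc n) - a n \<and> a (Suc n) - a n \<le> d (n0 - 2)" if "n \<ge> n0 - 2" for n
      using \<epsilon>(2)[OF that] d_le[OF that] by (simp add: d_def)
    then show ?thesis
      by (rule baker_domain_of_bounded_gaps[OF assms(3) a_nonneg _ \<epsilon>(1)]) blast+
  next
    case False
    have small: "\<exists>n\<ge>n0 - 2. d n \<le> \<epsilon>" if "0 < \<epsilon>" for \<epsilon>
      using False that by (meson not_le)
    show ?thesis
      by (rule baker_domain_of_vanishing_gaps[OF assms(3) a_nonneg assms(1) d_def decr small]) blast+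
  qed
  then show ?thesis
    unfolding grows_like_def .
qed

end
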